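(* Let $H$ be a finite connected multigraph with loops (in the sense of the context) whose minimal degree is at least $2$ and whose maximal degree is greater than $2$. Let $\rho(\tilde{H})$ be the growth rate of the universal covering tree $\tilde H$ of $H$. Then there are constants $c_1,c_2>0$ and $g_0$ (depending only on $H$) such that for all integers $g\ge g_0$, $$c_1\,\rho(\tilde H)^{g/2}\;\le\; n(H,g)\;\le\; c_2\,\rho(\tilde H)^{g},$$ i.e. $\Omega(\rho(\tilde H)^{g/2})\le n(H,g)\le O(\rho(\tilde H)^g)$ as $g\to\infty$.
   Context: A graph (multigraph with loops) $H=(V,\overline{E},h,t,\iota)$ consists of a vertex set $V$, a set $\overline E$ of directed edges, head and tail maps $h,t:\overline E\to V$, and an involution $\iota:e\mapsto e^{-1}$ on $\overline E$ with $h(e^{-1})=t(e)$. An edge with $h(e)=t(e)$ is a loop: a half-loop if $e=e^{-1}$, a whole-loop otherwise. The degree of $v$ is $\deg(v)=|t^{-1}(v)|$ (a half-loop contributes $1$, a whole-loop $2$). A walk is a sequence of directed edges $e_1,\dots,e_k$ with $h(e_i)=t(e_{i+1})$; it is non-backtracking if $e_{i+1}\neq e_i^{-1}$ for all $i$. Distance $\mathrm{dist}(u,v)$ is the length of a shortest walk; $B_r(v)=\{u:\mathrm{dist}(u,v)\le r\}$. The girth of a graph is the length of its shortest cycle (loops count as cycles of length $1$, a pair of parallel edges gives a cycle of length $2$). A finite graph $G$ is a lift of (covers) $H$ if there is a surjective homomorphism $\pi:G\to H$ (mapping vertices to vertices and directed edges to directed edges, compatible with $h,t,\iota$) such that for every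 $v\in V(G)$, $\pi$ maps $t^{-1}(v)$ bijectively onto $t^{-1}(\pi(v))$. For $H$ as in the claim, $n(H,g)$ denotes the smallest number of vertices of a (finite) lift of $H$ with girth at least $g$. The universal cover $\tilde H$ is the infinite tree whose vertices are the finite non-backtracking walks in $H$ starting at a fixed vertex $v_0$, two walks being adjacent if one extends the other by one edge. Its growth rate is $\rho(\tilde H)=\lim_{r\to\infty}|B_r(v)|^{1/r}$ for a vertex $v$ of $\tilde H$ (under the hypotheses this limit exists, is independent of $v$, and equals the spectral radius of the non-backtracking matrix of $H$). *)

theory Defs
  imports "HOL-Analysis.Analysis" "Graph_Theory.Graph_Theory"
begin

text \<open>
  A multigraph with loops is a digraph from \<^theory>\<open>Graph_Theory.Graph_Theory\<close> together with an
  involution \<open>\<iota>\<close> on its arcs that reverses directions.  Fixed points of \<open>\<iota>\<close> (half-loops) are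
  allowed, which is why the library locale \<^locale>\<open>bidirected_digraph\<close> cannot be used: it requires
  the reversal to be fixed-point free on arcs.  The degree of a vertex is \<^const>\<open>out_degree\<close>, the
  number of arcs with that tail.
\<close>

locale multigraph = wf_digraph G for G :: "('v, 'e) pre_digraph" +
  fixes \<iota> :: "'e \<Rightarrow> 'e"
  assumes inv_in_arcs: "e \<in> arcs G \<Longrightarrow> \<iota> e \<in> arcs G"
    and inv_inv: "e \<in> arcs G \<Longrightarrow> \<iota> (\<iota> e) = e"
    and head_inv: "e \<in> arcs G \<Longrightarrow> head G (\<iota> e) = tail G e"

locale fin_multigraph = multigraph G \<iota> + fin_digraph G
  for G :: "('v, 'e) pre_digraph" and \<iota> :: "'e \<Rightarrow> 'e"

definition non_backtracking :: "('e \<Rightarrow> 'e) \<Rightarrow> 'e list \<Rightarrow> bool" where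
  "non_backtracking \<iota> p \<longleftrightarrow> successively (\<lambda>e e'. e' \<noteq> \<iota> e) p"

text \<open>
  The library's \<^const>\<open>pre_digraph.cycle\<close> is a nonempty closed walk without repeated vertices.
  Non-backtracking only has an effect in length \<open>2\<close>, where it excludes an edge traversed back and
  forth.  There is no condition between the last and the first arc, so that half-loops count as
  cycles of length \<open>1\<close>, just as whole-loops do.  The girth of an acyclic graph is \<open>\<infinity>\<close>.
\<close>

definition girth :: "('v, 'e) pre_digraph \<Rightarrow> ('e \<Rightarrow> 'e) \<Rightarrow> enat" where
  "girth G \<iota> = (INF p\<in>{p. pre_digraph.cycle G p \<and> non_backtracking \<iota> p}. enat (length p))"

definition graph_dist :: "('v, 'e) pre_digraph \<Rightarrow> 'v \<Rightarrow> 'v \<Rightarrow> enat" where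
  "graph_dist G u v = (INF p\<in>{p. pre_digraph.awalk G u p v}. enat (length p))"

definition graph_ball :: "('v, 'e) pre_digraph \<Rightarrow> nat \<Rightarrow> 'v \<Rightarrow> 'v set" where
  "graph_ball G r v = {u \<in> verts G. graph_dist G u v \<le> enat r}"

definition covering_map ::
  "('w, 'f) pre_digraph \<Rightarrow> ('f \<Rightarrow> 'f) \<Rightarrow> ('v, 'e) pre_digraph \<Rightarrow> ('e \<Rightarrow> 'e)
    \<Rightarrow> ('w \<Rightarrow> 'v) \<Rightarrow> ('f \<Rightarrow> 'e) \<Rightarrow> bool" where
  "covering_map G \<iota>G H \<iota>H \<pi>v \<pi>e \<longleftrightarrow>
     \<pi>v ` verts G = verts H \<and> \<pi>e ` arcs G = arcs H \<and>
     (\<forall>e\<in>arcs G. tail H (\<pi>e e) = \<pi>v (tail G e) \<and> head H (\<pi>e e) = \<pi>v (head G e)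
                  \<and> \<pi>e (\<iota>G e) = \<iota>H (\<pi>e e)) \<and>
     (\<forall>v\<in>verts G. bij_betw \<pi>e (out_arcs G v) (out_arcs H (\<pi>v v)))"

definition is_lift ::
  "('w, 'f) pre_digraph \<Rightarrow> ('f \<Rightarrow> 'f) \<Rightarrow> ('v, 'e) pre_digraph \<Rightarrow> ('e \<Rightarrow> 'e) \<Rightarrow> bool" where
  "is_lift G \<iota>G H \<iota>H \<longleftrightarrow> (\<exists>\<pi>v \<pi>e. covering_map G \<iota>G H \<iota>H \<pi>v \<pi>e)"

text \<open>
  The smallest number of vertices of a finite lift of girth at least \<open>g\<close>, with value \<open>\<infinity>\<close> if there
  is no such lift.  Every finite multigraph is isomorphic to one whose vertices and arcs are natural
  numbers, so it suffices to let \<open>G\<close> range over these.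
\<close>

definition min_lift_size :: "('v, 'e) pre_digraph \<Rightarrow> ('e \<Rightarrow> 'e) \<Rightarrow> nat \<Rightarrow> enat" where
  "min_lift_size H \<iota> g =
     Inf {enat (card (verts G)) | (G :: (nat, nat) pre_digraph) \<iota>G.
            fin_multigraph G \<iota>G \<and> is_lift G \<iota>G H \<iota> \<and> girth G \<iota>G \<ge> enat g}"

definition nb_walks :: "('v, 'e) pre_digraph \<Rightarrow> ('e \<Rightarrow> 'e) \<Rightarrow> 'v \<Rightarrow> 'e list set" where
  "nb_walks H \<iota> v0 = {p. (\<exists>v. pre_digraph.awalk H v0 p v) \<and> non_backtracking \<iota> p}"

text \<open>
  An arc of the universal cover is an ordered pair of adjacent walks; its reversal is
  \<^const>\<open>prod.swap\<close>.
\<close>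

definition universal_cover ::
  "('v, 'e) pre_digraph \<Rightarrow> ('e \<Rightarrow> 'e) \<Rightarrow> 'v \<Rightarrow> ('e list, 'e list \<times> 'e list) pre_digraph" where
  "universal_cover H \<iota> v0 =
     \<lparr>verts = nb_walks H \<iota> v0,
      arcs = {(p, q). p \<in> nb_walks H \<iota> v0 \<and> q \<in> nb_walks H \<iota> v0 \<and>
                      (\<exists>e. q = p @ [e] \<or> p = q @ [e])},
      tail = fst, head = snd\<rparr>"

definition growth_rate :: "('v, 'e) pre_digraph \<Rightarrow> 'v \<Rightarrow> real" where
  "growth_rate T v = lim (\<lambda>r. real (card (graph_ball T r v)) powr (1 / real r))"

end

theory Submission
  imports Defs
begin

text \<open>
  On a finite connected graph of minimal degree at least \<open>2\<close> and maximal degree greater than \<open>2\<close>,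
  the relation "may follow in a non-backtracking walk" on arcs is irreducible. By Fekete's
  argument the number of non-backtracking walks of length \<open>n\<close> is therefore \<open>\<Theta>(\<rho> ^ n)\<close>, and \<open>\<rho>\<close> is
  the growth rate of the universal cover. The lower bound is Moore's: in a lift of girth at least
  \<open>g\<close>, non-backtracking walks of length \<open>(g - 1) div 2\<close> that continue a fixed arc have distinct
  ends. For the upper bound, among the lifts with a given number of sheets and no closed walk of
  length less than \<open>k\<close> take one with the fewest cyclically non-backtracking closed walks of length
  \<open>k\<close>. If there is such a walk, and more than a constant times \<open>\<rho> ^ k\<close> sheets, then some arc \<open>y\<close>
  in the fibre of an arc \<open>x\<close> of that walk is far away from \<open>x\<close>, and exchanging the reversals of
  \<open>x\<close> and \<open>y\<close> lowers the number.
\<close>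

section \<open>Exponential growth of an irreducible relation\<close>

text \<open>The start \<open>x\<close> is kept out of the list, so that \<open>n\<close> counts
  steps and the empty list is the single chain of length \<open>0\<close> at every
  \<open>x\<close>.\<close>

definition chains :: "('a \<Rightarrow> 'a \<Rightarrow> bool) \<Rightarrow> nat \<Rightarrow> 'a \<Rightarrow> 'a list set" where
  "chains R n x = {p. length p = n \<and> successively R (x # p)}"

lemma chains_0 [simp]: "chains R 0 x = {[]}"
  by (auto simp: chains_def)

lemma chains_Suc: "chains R (Suc n) x = (\<Union>y\<in>{y. R x y}. (#) y ` chains R n y)"
  by (auto simp: chains_def length_Suc_conv image_iff)

locale finitely_branching =
  fixes R :: "'a \<Rightarrow> 'a \<Rightarrow> bool"
  assumes finite_successors: "finite {y. R x y}"
begin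

lemma finite_chains: "finite (chains R n x)"
  by (induction n arbitrary: x) (auto simp: chains_Suc finite_successors)

lemma card_chains_Suc: "card (chains R (Suc n) x) = (\<Sum>y | R x y. card (chains R n y))"
  unfolding chains_Suc
  by (subst card_UN_disjoint) (auto simp: finite_successors finite_chains card_image)

text \<open>Prefixing a fixed path of length \<open>l\<close> from \<open>x\<close> to
  \<open>y\<close> injects the chains at \<open>y\<close> into those at \<open>x\<close>.\<close>

lemma card_chains_le_reach:
  assumes "(R ^^ l) x y"
  shows "card (chains R n y) \<le> card (chains R (l + n) x)"
  using assms
proof (induction l arbitrary: x)
  case (Suc l)
  obtain z where z: "R x z" "(R ^^ l) z y"
    using relpowp_Suc_D2[OF Suc.prems] by blast
  have "card (chains R n y) \<le> card (chains R (l + n) z)"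
    by (rule Suc.IH[OF z(2)])
  also have "\<dots> \<le> (\<Sum>z | R x z. card (chains R (l + n) z))"
    using z(1) finite_successors by (intro member_le_sum) auto
  finally show ?case by (simp add: card_chains_Suc)
qed simp

end

text \<open>
  Taking \<open>\<rho>\<close> to be the infimum of the \<open>n\<close>-th roots of \<open>a n\<close>, the inequality \<open>(c * a n) ^ m \<le> a m ^ n\<close>
  gives the bound on \<open>c * a n\<close> without any limit.
\<close>

lemma submultiplicative_growth:
  fixes a :: "nat \<Rightarrow> real"
  assumes pos: "\<And>n. a n \<ge> 1" and sub: "\<And>m n. a (m + n) \<le> a m * a n"
    and c: "c > 0" and super: "\<And>m n. a (m + n) \<ge> c * a m * a n"
  obtains \<rho> where "\<rho> \<ge> 1" "\<And>n. \<rho> ^ n \<le> a n" "\<And>n. c * a n \<le> \<rho> ^ n"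
proof -
  have sub_pow: "a (n * k) \<le> a n ^ k" if "k > 0" for n k
    using that
  proof (induction k)
    case (Suc k)
    have "a (n * Suc k) \<le> a n * a (n * k)" using sub[of n "n * k"] by simp
    also have "\<dots> \<le> a n * a n ^ k" if "k > 0"
      using Suc.IH that pos[of n] by (intro mult_left_mono) auto
    finally show ?case by (cases "k = 0") auto
  qed simp
  have super_pow: "(c * a n) ^ k \<le> c * a (n * k)" if "k > 0" for n k
    using that
  proof (induction k)
    case (Suc k)
    show ?case
    proof (cases "k = 0")
      case False
      have "(c * a n) ^ Suc k \<le> (c * a n) * (c * a (n * k))"
        using Suc.IH False pos[of n] c by (simp add: mult_left_mono)
      also have "\<dots> = c * (c * a n * a (n * k))" by simp
      also have "\<dots> \<le> c * a (n + n * k)"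
        using super[of n "n * k"] c by (intro mult_left_mono) auto
      finally show ?thesis by simp
    qed simp
  qed simp
  \<comment> \<open>Both sides are compared through \<open>a (n * m * k)\<close>. If the inequality
    failed, the quotient \<open>q\<close> would exceed \<open>1\<close> while all its positive
    powers stay below \<open>c\<close>.\<close>
  have cross: "(c * a n) ^ m \<le> a m ^ n" if "m > 0" "n > 0" for m n
  proof (rule ccontr)
    assume "\<not> ?thesis"
    then have lt: "a m ^ n < (c * a n) ^ m" by simp
    have am: "a m ^ n > 0" using pos[of m] by (simp add: less_le_trans[OF zero_less_one])
    define q where "q = (c * a n) ^ m / a m ^ n"
    have "q > 1" using lt am by (simp add: q_def)
    have "q ^ k \<le> c" if "k > 0" for k
    proof -
      have "((c * a n) ^ m) ^ k \<le> c * a (n * (m * k))"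
        using super_pow[of "m * k" n] that \<open>m > 0\<close> by (simp add: power_mult)
      also have "a (n * (m * k)) \<le> a m ^ (n * k)"
        using sub_pow[of "n * k" m] that \<open>n > 0\<close> by (simp add: mult.left_commute)
      finally have "((c * a n) ^ m) ^ k \<le> c * (a m ^ n) ^ k"
        using c by (simp add: power_mult)
      then show ?thesis using am by (simp add: q_def power_divide pos_divide_le_eq)
    qed
    moreover obtain k where "c < q ^ k" using real_arch_pow[OF \<open>q > 1\<close>] by blast
    moreover have "q ^ k \<le> q ^ Suc k" using \<open>q > 1\<close> by (intro power_increasing) auto
    ultimately show False by (meson le_less_trans not_less zero_less_Suc less_le_trans)
  qed
  define \<rho> where "\<rho> = (INF n\<in>{0<..}. root n (a n))"
  have ge1: "root n (a n) \<ge> 1" if "n > 0" for n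
    using that pos[of n] by simp
  have bdd: "bdd_below ((\<lambda>n. root n (a n)) ` {0<..})"
    using ge1 by (intro bdd_belowI[of _ 1]) auto
  \<comment> \<open>The infimum defining \<open>\<rho>\<close> only involves roots of positive
    order, so index \<open>0\<close> is treated apart.\<close>
  have a0: "a 0 \<ge> 1" "c * a 0 \<le> 1"
  proof -
    have "c * a 0 * a 0 \<le> a 0" using super[of 0 0] by simp
    then show "c * a 0 \<le> 1" using pos[of 0] by (simp add: mult_le_cancel_right1)
  qed (use pos in simp)
  show thesis
  proof
    show "\<rho> \<ge> 1" unfolding \<rho>_def using ge1 by (intro cINF_greatest) auto
    show "\<rho> ^ n \<le> a n" for n
    proof (cases "n = 0")
      case False
      have "\<rho> \<le> root n (a n)" unfolding \<rho>_def using False by (intro cINF_lower bdd) auto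
      then have "\<rho> ^ n \<le> root n (a n) ^ n" using \<open>\<rho> \<ge> 1\<close> by (intro power_mono) auto
      also have "\<dots> = a n" using False pos[of n] by simp
      finally show ?thesis .
    qed (use a0 in simp)
    show "c * a n \<le> \<rho> ^ n" for n
    proof (cases "n = 0")
      case False
      \<comment> \<open>This is the \<open>m * n\<close>-th root of \<open>cross\<close>; it makes
        the left side a lower bound for all members of the infimum.\<close>
      have "root n (c * a n) \<le> root m (a m)" if "m > 0" for m
      proof -
        have "root n (c * a n) = root (m * n) ((c * a n) ^ m)"
          using that False c pos[of n] by (simp add: real_root_mult_exp real_root_power_cancel real_root_commute
            real_root_power mult.commute)
        also have "\<dots> \<le> root (m * n) (a m ^ n)"
          using cross[of m n] that False by simp
        also have "\<dots> = root m (a m)"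
          using that False pos[of m] by (simp add: real_root_mult_exp real_root_power_cancel)
        finally show ?thesis .
      qed
      then have "root n (c * a n) \<le> \<rho>" unfolding \<rho>_def by (intro cINF_greatest) auto
      then have "root n (c * a n) ^ n \<le> \<rho> ^ n"
        using False c pos[of n] by (intro power_mono) auto
      then show ?thesis using False c pos[of n] by simp
    qed (use a0 in simp)
  qed
qed

section \<open>Chain counts of a finite irreducible relation\<close>

locale irreducible_branching = finitely_branching R
  for R :: "'a \<Rightarrow> 'a \<Rightarrow> bool" +
  fixes A :: "'a set"
  assumes finite_carrier: "finite A"
    and closed: "R x y \<Longrightarrow> x \<in> A \<Longrightarrow> y \<in> A"
    and total: "x \<in> A \<Longrightarrow> \<exists>y. R x y"
    and irreducible: "x \<in> A \<Longrightarrow> y \<in> A \<Longrightarrow> R\<^sup>*\<^sup>* x y"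
    and branching: "\<exists>x\<in>A. \<exists>y z. R x y \<and> R x z \<and> y \<noteq> z"
begin

abbreviation N :: "nat \<Rightarrow> 'a \<Rightarrow> nat" where "N n x \<equiv> card (chains R n x)"

text \<open>By \<open>total\<close> every chain can be prolonged. The induction compares the sums
  over first steps termwise, which leaves only positivity of the counts for the base case.\<close>

lemma N_mono: "x \<in> A \<Longrightarrow> m \<le> n \<Longrightarrow> N m x \<le> N n x"
proof (induction m arbitrary: n x)
  case 0
  have "N n x > 0" if "x \<in> A" for n x
    using that
  proof (induction n arbitrary: x)
    case (Suc n)
    obtain y where "R x y" using total Suc.prems by blast
    then have "0 < N n y" "N n y \<le> N (Suc n) x"
      using Suc card_chains_le_reach[of 1 x y n] closed by auto
    then show ?case by simp
  qed simp
  from this[of x n] show ?case using 0 by simp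
next
  case (Suc m)
  then obtain k where n: "n = Suc k" and "m \<le> k" by (cases n) auto
  show ?case unfolding n card_chains_Suc
    using Suc \<open>m \<le> k\<close> closed by (intro sum_mono) auto
qed

lemma bounded_reach: "\<exists>L. \<forall>x\<in>A. \<forall>y\<in>A. \<exists>l\<le>L. (R ^^ l) x y"
proof -
  have "\<exists>l. (R ^^ l) x y" if "x \<in> A" "y \<in> A" for x y
    using irreducible[OF that] by (simp add: rtranclp_power)
  then obtain l where l: "\<And>x y. x \<in> A \<Longrightarrow> y \<in> A \<Longrightarrow> (R ^^ l x y) x y" by metis
  have "l x y \<le> Max ((\<lambda>(x, y). l x y) ` (A \<times> A))" if "x \<in> A" "y \<in> A" for x y
    using that finite_carrier by (intro Max_ge) auto
  with l show ?thesis by blast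
qed

text \<open>Cut the chain after \<open>m\<close> steps: its end lies in \<open>A\<close> by
  \<open>closed\<close>, and from there at most \<open>B\<close> continuations exist.\<close>

lemma N_add_le:
  assumes "x \<in> A" and B: "\<And>y. y \<in> A \<Longrightarrow> N n y \<le> B"
  shows "N (m + n) x \<le> N m x * B"
  using assms(1)
proof (induction m arbitrary: x)
  case (Suc m)
  have "N (Suc m + n) x \<le> (\<Sum>y | R x y. N m y * B)"
    using Suc closed by (auto simp: card_chains_Suc intro!: sum_mono)
  then show ?case by (simp add: card_chains_Suc sum_distrib_right)
qed (use B in simp)

lemma N_add_ge:
  assumes "x \<in> A" and B: "\<And>y. y \<in> A \<Longrightarrow> B \<le> N n y"
  shows "N m x * B \<le> N (m + n) x"
  using assms(1)
proof (induction m arbitrary: x)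
  case (Suc m)
  have "(\<Sum>y | R x y. N m y * B) \<le> N (Suc m + n) x"
    using Suc closed by (auto simp: card_chains_Suc intro!: sum_mono)
  then show ?case by (simp add: card_chains_Suc sum_distrib_right)
qed (use B in simp)

text \<open>Irreducibility makes the counts from different starting points comparable up to a fixed
  factor. Hence their maximum \<open>a n\<close> is submultiplicative, and supermultiplicative up to
  the factor \<open>1 / a L\<close>, so that \<open>submultiplicative_growth\<close> applies. The
  constant \<open>C\<close> is \<open>a L\<close>.\<close>

theorem exponential_growth:
  obtains \<rho> C :: real where "\<rho> > 1" "C > 0"
    "\<And>n x. x \<in> A \<Longrightarrow> \<rho> ^ n \<le> C * N n x" "\<And>n x. x \<in> A \<Longrightarrow> N n x \<le> C * \<rho> ^ n"
proof -
  obtain L where L: "\<And>x y. x \<in> A \<Longrightarrow> y \<in> A \<Longrightarrow> \<exists>l\<le>L. (R ^^ l) x y"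
    using bounded_reach by metis
  obtain x0 y0 z0 where xyz: "x0 \<in> A" "R x0 y0" "R x0 z0" "y0 \<noteq> z0" using branching by blast
  define a where "a n = Max (N n ` A)" for n
  have a_upper: "N n x \<le> a n" if "x \<in> A" for n x
    unfolding a_def using finite_carrier that by auto
  have a_attained: "\<exists>x\<in>A. N n x = a n" for n
  proof -
    have "Max (N n ` A) \<in> N n ` A" using finite_carrier xyz(1) by (intro Max_in) auto
    then obtain x where "Max (N n ` A) = N n x" "x \<in> A" by (rule imageE)
    then show ?thesis by (auto simp: a_def)
  qed
  \<comment> \<open>Walk from \<open>x\<close> to \<open>y\<close> in \<open>l\<close> steps;
    monotonicity then pads \<open>l + n\<close> to the uniform length \<open>n + L\<close>.\<close>
  have spread: "N n y \<le> N (n + L) x" if xy: "x \<in> A" "y \<in> A" for n x y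
  proof -
    obtain l where l: "l \<le> L" "(R ^^ l) x y" using L xy by blast
    have "N n y \<le> N (l + n) x" by (rule card_chains_le_reach[OF l(2)])
    also have "\<dots> \<le> N (n + L) x" using l xy by (intro N_mono) auto
    finally show ?thesis .
  qed
  have near_max: "a n \<le> N n x * a L" if x: "x \<in> A" for n x
  proof -
    obtain y where y: "y \<in> A" "N n y = a n" using a_attained by blast
    have "N n y \<le> N (n + L) x" using spread x y by blast
    also have "\<dots> \<le> N n x * a L" using a_upper x by (intro N_add_le) auto
    finally show ?thesis using y by simp
  qed
  have a_pos: "a n \<ge> 1" for n
    using a_upper[OF xyz(1), of n] N_mono[OF xyz(1), of 0 n] by simp
  have sub: "real (a (m + n)) \<le> real (a m) * real (a n)" for m n
  proof -
    obtain y where y: "y \<in> A" "N (m + n) y = a (m + n)" using a_attained by blast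
    have "N (m + n) y \<le> N m y * a n" by (rule N_add_le[OF y(1) a_upper])
    then have "a (m + n) \<le> N m y * a n" by (simp only: y(2))
    also have "\<dots> \<le> a m * a n" using a_upper y by simp
    finally show ?thesis by (simp flip: of_nat_mult)
  qed
  have super: "real (a (m + n)) \<ge> 1 / a L * real (a m) * real (a n)" for m n
  proof -
    obtain y where y: "y \<in> A" "N m y = a m" using a_attained by blast
    \<comment> \<open>Each chain of length \<open>m\<close> has at least \<open>b\<close>
      continuations, and \<open>near_max\<close> says that the minimum \<open>b\<close> is smaller
      than the maximum \<open>a n\<close> by at most the factor \<open>a L\<close>.\<close>
    define b where "b = Min (N n ` A)"
    have b: "b \<le> N n z" if "z \<in> A" for z unfolding b_def using finite_carrier that by auto
    have "b \<in> N n ` A" unfolding b_def using finite_carrier xyz(1) by (intro Min_in) auto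
    then obtain x where x: "b = N n x" "x \<in> A" by (rule imageE)
    have "a n \<le> b * a L" unfolding x(1) by (rule near_max[OF x(2)])
    then have "a m * a n \<le> (N m y * b) * a L"
      unfolding y(2) mult.assoc by (rule mult_left_mono) simp
    also have "\<dots> \<le> N (m + n) y * a L" using b y by (intro mult_right_mono N_add_ge) auto
    also have "\<dots> \<le> a (m + n) * a L" using a_upper y by simp
    finally have "real (a m) * a n \<le> real (a (m + n)) * a L" by (simp flip: of_nat_mult)
    then show ?thesis using a_pos[of L] by (simp add: pos_divide_le_eq)
  qed
  have real_a_pos: "real (a n) \<ge> 1" for n using a_pos[of n] by simp
  have c_pos: "1 / real (a L) > 0" using a_pos[of L] by simp
  obtain \<rho> :: real where \<rho>: "\<rho> \<ge> 1" "\<And>n. \<rho> ^ n \<le> a n" "\<And>n. 1 / a L * a n \<le> \<rho> ^ n"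
    by (rule submultiplicative_growth[of "\<lambda>n. real (a n)", OF real_a_pos sub c_pos super]) (rule that)
  have aL: "real (a L) \<ge> 1" using a_pos[of L] by simp
  have upper: "N n x \<le> a L * \<rho> ^ n" if "x \<in> A" for n x
  proof -
    have "real (N n x) \<le> a n" using a_upper that by simp
    also have "\<dots> \<le> a L * \<rho> ^ n" using \<rho>(3)[of n] aL by (simp add: divide_le_eq mult.commute)
    finally show ?thesis .
  qed
  \<comment> \<open>At most \<open>L\<close> steps lead to \<open>x0\<close> and one more step
    branches to \<open>y0\<close> or \<open>z0\<close>, so the count doubles every
    \<open>Suc L\<close> steps. This excludes \<open>\<rho> = 1\<close>, for which
    \<open>upper\<close> would bound all counts by \<open>a L\<close>.\<close>
  have double: "2 ^ k \<le> N (k * Suc L) x" if "x \<in> A" for k x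
    using that
  proof (induction k arbitrary: x)
    case (Suc k)
    have "2 * 2 ^ k = (\<Sum>y\<in>{y0, z0}. 2 ^ k :: nat)" using xyz by simp
    also have "\<dots> \<le> (\<Sum>y\<in>{y0, z0}. N (k * Suc L) y)"
      using Suc.IH xyz closed by (intro sum_mono) auto
    also have "\<dots> \<le> (\<Sum>y | R x0 y. N (k * Suc L) y)"
      using xyz finite_successors by (intro sum_mono2) auto
    also have "\<dots> = N (Suc (k * Suc L)) x0" by (simp add: card_chains_Suc)
    also have "\<dots> \<le> N (Suc (k * Suc L) + L) x" using spread xyz Suc by blast
    finally show ?case by (simp add: add_ac)
  qed simp
  have "\<rho> \<noteq> 1"
  proof
    assume "\<rho> = 1"
    have "(1 :: real) < 2" by simp
    from real_arch_pow[OF this] obtain k where k: "real (a L) < 2 ^ k" by blast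
    have "real (2 ^ k) \<le> N (k * Suc L) x0" using double[OF xyz(1), of k] of_nat_le_iff by blast
    then show False using upper[OF xyz(1), of "k * Suc L"] k \<open>\<rho> = 1\<close> by simp
  qed
  show thesis
  proof
    show "\<rho> > 1" using \<rho>(1) \<open>\<rho> \<noteq> 1\<close> by simp
    show "real (a L) > 0" using aL by simp
    show "\<rho> ^ n \<le> real (a L) * N n x" if "x \<in> A" for n x
    proof -
      have "\<rho> ^ n \<le> a n" by (rule \<rho>)
      also have "\<dots> \<le> real (a L) * N n x" using near_max[OF that, of n] by (simp add: mult.commute flip: of_nat_mult)
      finally show ?thesis .
    qed
  qed (use upper in auto)
qed

end

section \<open>Non-backtracking walks\<close>

lemma finite_nonempty_singleton_cases:
  assumes "finite A" "A \<noteq> {}"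
  obtains x where "A = {x}" | x y where "x \<in> A" "y \<in> A" "x \<noteq> y"
  using assms by blast

context multigraph
begin

lemma tail_inv: "e \<in> arcs G \<Longrightarrow> tail G (\<iota> e) = head G e"
  using head_inv[OF inv_in_arcs] inv_inv by simp

lemma inv_eq_iff: "a \<in> arcs G \<Longrightarrow> b \<in> arcs G \<Longrightarrow> \<iota> a = b \<longleftrightarrow> a = \<iota> b"
  using inv_inv by auto

text \<open>This gives the equality of in-degree and out-degree on which the counting in
  \<open>nb_closed_set_eq_arcs\<close> rests.\<close>

lemma bij_betw_inv: "bij_betw \<iota> (in_arcs G v) (out_arcs G v)"
  by (intro bij_betwI[of _ _ _ \<iota>]) (auto simp: inv_in_arcs inv_inv tail_inv head_inv)

text \<open>The adjacency matrix of this relation on arcs is the non-backtracking (Hashimoto)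
  matrix.\<close>

definition nb_step :: "'e \<Rightarrow> 'e \<Rightarrow> bool" where
  "nb_step a b \<longleftrightarrow> a \<in> arcs G \<and> b \<in> arcs G \<and> tail G b = head G a \<and> b \<noteq> \<iota> a"

lemma nb_step_inv: "nb_step a b \<Longrightarrow> nb_step (\<iota> b) (\<iota> a)"
  by (auto simp: nb_step_def inv_in_arcs tail_inv head_inv inv_eq_iff inv_inv)

definition nb_awalk :: "'v \<Rightarrow> 'e list \<Rightarrow> 'v \<Rightarrow> bool" where
  "nb_awalk u p v \<longleftrightarrow> awalk u p v \<and> non_backtracking \<iota> p"

lemma nb_awalk_Nil [simp]: "nb_awalk u [] v \<longleftrightarrow> u = v \<and> u \<in> verts G"
  by (auto simp: nb_awalk_def awalk_Nil_iff non_backtracking_def)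

lemma nb_awalk_Cons_iff:
  "nb_awalk u (a # p) v \<longleftrightarrow>
    a \<in> arcs G \<and> tail G a = u \<and> (p = [] \<or> hd p \<noteq> \<iota> a) \<and> nb_awalk (head G a) p v"
  by (auto simp: nb_awalk_def awalk_Cons_iff non_backtracking_def successively_Cons)

text \<open>Translates walks between vertices into chains of arcs. An empty list does not determine
  its end vertices, hence the restriction to nonempty \<open>p\<close>.\<close>

lemma nb_awalk_iff:
  assumes "p \<noteq> []"
  shows "nb_awalk u p v \<longleftrightarrow>
    set p \<subseteq> arcs G \<and> successively nb_step p \<and> tail G (hd p) = u \<and> head G (last p) = v"
  using assms
proof (induction p arbitrary: u rule: list_nonempty_induct)
  case (single a)
  then show ?case by (auto simp: nb_awalk_Cons_iff)
next
  case (cons a p)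
  have "hd p \<in> arcs G" if "set p \<subseteq> arcs G" using that hd_in_set[OF cons(1)] by blast
  then show ?case
    using cons(1) by (auto simp: nb_awalk_Cons_iff cons.IH successively_Cons nb_step_def)
qed

lemma nb_awalk_appendI:
  assumes "nb_awalk u p v" "nb_awalk v q w" "p \<noteq> [] \<Longrightarrow> q \<noteq> [] \<Longrightarrow> hd q \<noteq> \<iota> (last p)"
  shows "nb_awalk u (p @ q) w"
  using assms by (auto simp: nb_awalk_def non_backtracking_def successively_append_iff)

lemma nb_awalk_appendD:
  assumes "nb_awalk u (p @ q) w"
  obtains v where "nb_awalk u p v" "nb_awalk v q w"
  using assms by (auto simp: nb_awalk_def non_backtracking_def successively_append_iff)

lemma nb_awalk_rev:
  assumes "nb_awalk u p v"
  shows "nb_awalk v (rev (map \<iota> p)) u"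
proof (cases "p = []")
  case False
  then have "successively nb_step p" "set p \<subseteq> arcs G" using assms by (auto simp: nb_awalk_iff)
  then have "successively (\<lambda>a b. nb_step (\<iota> b) (\<iota> a)) p"
    by (auto elim!: successively_mono simp: nb_step_inv)
  moreover have "hd p \<in> arcs G" "last p \<in> arcs G"
    using False \<open>set p \<subseteq> arcs G\<close> by (auto simp: subset_iff)
  ultimately show ?thesis
    using False assms
    by (auto simp: nb_awalk_iff successively_rev successively_map hd_rev last_rev hd_map last_map
        tail_inv head_inv inv_in_arcs)
qed (use assms in auto)

text \<open>The only gap between the two sides is that \<open>chains\<close> does not ask for
  members of \<open>arcs G\<close>; \<open>nb_step\<close> supplies this arc by arc.\<close>

lemma chains_eq_nb_awalks:
  assumes "a \<in> arcs G"
  shows "chains nb_step n a = {p. length p = n \<and> (\<exists>v. nb_awalk (tail G a) (a # p) v)}"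
proof -
  have "set p \<subseteq> arcs G" if "successively nb_step (a # p)" for p
    using that assms
  proof (induction p arbitrary: a)
    case (Cons b p)
    then show ?case using Cons.IH[of b] by (auto simp: nb_step_def)
  qed simp
  then show ?thesis using assms by (auto simp: chains_def nb_awalk_iff)
qed

section \<open>Irreducibility of the non-backtracking relation\<close>

lemma closed_set_eq_verts:
  assumes "Digraph_Component.connected G" "P \<noteq> {}" "P \<subseteq> verts G"
    and closed: "\<And>a. a \<in> arcs G \<Longrightarrow> tail G a \<in> P \<Longrightarrow> head G a \<in> P"
  shows "P = verts G"
proof -
  \<comment> \<open>The involution makes the arc relation symmetric, which upgrades connectedness to
    directed reachability; membership in \<open>P\<close> then propagates along arcs.\<close>
  have "symmetric G"
    unfolding symmetric_conv using inv_in_arcs head_inv tail_inv by metis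
  then have sc: "strongly_connected G"
    using assms(1) by (simp add: symmetric_connected_imp_strongly_connected)
  obtain u where u: "u \<in> P" using assms(2) by blast
  have "v \<in> P" if "v \<in> verts G" for v
  proof -
    have "u \<rightarrow>\<^sup>*\<^bsub>G\<^esub> v" using sc u assms(3) that by (auto simp: strongly_connected_def)
    then show ?thesis by (induction rule: reachable_induct) (use u closed in auto)
  qed
  then show ?thesis using assms(3) by blast
qed

end

sublocale fin_multigraph \<subseteq> finitely_branching nb_step
proof
  show "finite {y. nb_step x y}" for x
    by (rule finite_subset[OF _ finite_arcs]) (auto simp: nb_step_def)
qed

text \<open>
  A set of arcs closed under non-backtracking continuation has at each vertex at least as many
  outgoing as incoming arcs; summing over all vertices shows that equality holds everywhere.
\<close>

lemma (in fin_multigraph) nb_closed_set_eq_arcs: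
  assumes conn: "Digraph_Component.connected G"
    and deg: "\<And>v. v \<in> verts G \<Longrightarrow> out_degree G v \<ge> 2"
    and big: "v0 \<in> verts G" "out_degree G v0 > 2"
    and S: "S \<subseteq> arcs G" "S \<noteq> {}"
    and closed: "\<And>a b. a \<in> S \<Longrightarrow> nb_step a b \<Longrightarrow> b \<in> S"
  shows "S = arcs G"
proof -
  define In where "In v = {a \<in> S. head G a = v}" for v
  define Out where "Out v = {a \<in> S. tail G a = v}" for v
  have fin: "finite S" using S(1) finite_arcs by (rule finite_subset)
  have sub: "In v \<subseteq> in_arcs G v" "Out v \<subseteq> out_arcs G v" "finite (In v)" "finite (Out v)" for v
    using S fin by (auto simp: In_def Out_def)
  have card_in: "card (in_arcs G v) = card (out_arcs G v)" for v
    using bij_betw_inv bij_betw_same_card by blast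
  have cont: "out_arcs G v - {\<iota> a} \<subseteq> Out v" if "a \<in> In v" for a v
    using that closed S(1) by (auto simp: In_def Out_def nb_step_def)
  \<comment> \<open>Each incoming arc of \<open>S\<close> forces all outgoing arcs except its own
    reversal into \<open>S\<close>; two incoming arcs have different exceptions.\<close>
  have full: "Out v = out_arcs G v" if "a \<in> In v" "b \<in> In v" "a \<noteq> b" for a b v
  proof -
    have "\<iota> a \<noteq> \<iota> b" using that S(1) inv_inv unfolding In_def by (metis (mono_tags, lifting) mem_Collect_eq subsetD)
    then show ?thesis using cont[OF that(1)] cont[OF that(2)] sub(2) by blast
  qed
  have single: "card (Out v) \<ge> card (out_arcs G v) - 1" if "a \<in> In v" for a v
  proof -
    have "card (out_arcs G v) - 1 \<le> card (out_arcs G v - {\<iota> a})"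
      by (simp add: card_Diff_singleton_if)
    also have "\<dots> \<le> card (Out v)" using cont[OF that] sub by (intro card_mono) auto
    finally show ?thesis .
  qed
  \<comment> \<open>A single incoming arc forces at least one outgoing arc because the degree is at
    least \<open>2\<close>; with two or more, \<open>Out v\<close> is everything and in-degree
    equals out-degree.\<close>
  have le: "card (In v) \<le> card (Out v)" if v: "v \<in> verts G" for v
  proof (cases "In v = {}")
    case False
    from sub(3) this show ?thesis
    proof (cases rule: finite_nonempty_singleton_cases)
      case (1 a)
      then show ?thesis using single[of a v] deg[OF v] by (simp add: out_degree_def)
    next
      case (2 a b)
      then show ?thesis using full card_mono[OF _ sub(1)] card_in by (metis finite_in_arcs)
    qed
  qed simp
  have ends: "head G ` S \<subseteq> verts G" "tail G ` S \<subseteq> verts G" using S(1) by auto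
  \<comment> \<open>Both sums count \<open>S\<close> once, so the termwise inequality
    \<open>le\<close> must be an equality at each vertex.\<close>
  then have "(\<Sum>v\<in>verts G. card (In v)) = card S" "(\<Sum>v\<in>verts G. card (Out v)) = card S"
    using sum.group[OF fin finite_verts, of "head G" "\<lambda>_. 1 :: nat"]
      sum.group[OF fin finite_verts, of "tail G" "\<lambda>_. 1 :: nat"] ends
    by (auto simp: In_def Out_def)
  then have eq: "card (In v) = card (Out v)" if "v \<in> verts G" for v
    using sum_mono_inv[of "\<lambda>v. card (In v)" "verts G" "\<lambda>v. card (Out v)", OF _ le that] by simp
  define F where "F = {v \<in> verts G. In v = in_arcs G v \<and> Out v = out_arcs G v}"
  \<comment> \<open>A vertex entered by \<open>S\<close> is either full, or has degree
    \<open>2\<close> and \<open>S\<close> passes through it in one direction only.\<close>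
  have cases: "v \<in> F \<or> (\<exists>a b. In v = {a} \<and> Out v = {b} \<and> out_arcs G v = {\<iota> a, b} \<and> b \<noteq> \<iota> a)"
    if v: "v \<in> verts G" and "In v \<noteq> {}" for v
    using sub(3) that(2)
  proof (cases rule: finite_nonempty_singleton_cases)
    case (1 a)
    then have "card (Out v) = 1" using eq[OF v] by simp
    then obtain b where b: "Out v = {b}" by (auto simp: card_1_singleton_iff)
    have "card (out_arcs G v) = 2"
      using single[of a v] 1 b deg[OF v] by (simp add: out_degree_def)
    moreover have "out_arcs G v \<subseteq> {\<iota> a, b}" using cont[of a v] 1 b by auto
    moreover have "card {\<iota> a, b} \<le> 2" by (simp add: card_insert_if)
    ultimately have "out_arcs G v = {\<iota> a, b}" by (intro card_seteq) auto
    moreover from this have "b \<noteq> \<iota> a" using \<open>card (out_arcs G v) = 2\<close> by auto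
    ultimately show ?thesis using 1 b by blast
  next
    case (2 a b)
    then have Ov: "Out v = out_arcs G v" by (rule full)
    then have "In v = in_arcs G v"
      using eq[OF v] card_in sub(1) by (intro card_subset_eq) auto
    then show ?thesis using Ov v by (auto simp: F_def)
  qed
  show ?thesis
  proof (cases "F = {}")
    case False
    \<comment> \<open>Fullness spreads: an arc \<open>a\<close> leaving a full vertex lies in
      \<open>S\<close> together with its reversal, so \<open>S\<close> both enters the next vertex
      by \<open>a\<close> and leaves it by \<open>\<iota> a\<close>. This rules out the
      one-directional case there.\<close>
    have "F = verts G"
    proof (rule closed_set_eq_verts[OF conn False])
      fix a assume a: "a \<in> arcs G" "tail G a \<in> F"
      have "a \<in> out_arcs G (tail G a)" "\<iota> a \<in> in_arcs G (tail G a)"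
        using a(1) by (auto simp: inv_in_arcs head_inv)
      then have "a \<in> S" "\<iota> a \<in> S" using a(2) by (auto simp: F_def In_def Out_def)
      then have "a \<in> In (head G a)" "\<iota> a \<in> Out (head G a)"
        using a(1) by (auto simp: In_def Out_def tail_inv)
      moreover from this have "In (head G a) \<noteq> {}" by blast
      ultimately show "head G a \<in> F" using cases[of "head G a"] a(1) by fastforce
    qed (auto simp: F_def)
    then have "arcs G \<subseteq> S" using tail_in_verts by (fastforce simp: F_def Out_def)
    then show ?thesis using S(1) by blast
  next
    case True
    \<comment> \<open>Without full vertices each vertex of \<open>T\<close> has degree
      \<open>2\<close>, and one of its two arcs leads forward along \<open>S\<close>, the other
      backward. So \<open>T\<close> is closed and contains \<open>v0\<close>, whose degree is too
      large.\<close>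
    define T where "T = {v \<in> verts G. In v \<noteq> {}}"
    have O_T: "v \<in> T" if "v \<in> verts G" "Out v \<noteq> {}" for v
      using eq[OF that(1)] that sub by (auto simp: T_def)
    have "T = verts G"
    proof (rule closed_set_eq_verts[OF conn])
      fix a assume a: "a \<in> arcs G" "tail G a \<in> T"
      then have "tail G a \<in> verts G" "In (tail G a) \<noteq> {}" by (auto simp: T_def)
      from cases[OF this] True obtain c b where cb: "In (tail G a) = {c}" "Out (tail G a) = {b}"
        "out_arcs G (tail G a) = {\<iota> c, b}" by blast
      then have "c \<in> In (tail G a)" "b \<in> Out (tail G a)" by blast+
      then have cS: "c \<in> S" "c \<in> arcs G" "b \<in> S" using S(1) unfolding In_def Out_def by blast+
      have "a \<in> out_arcs G (tail G a)" using a(1) by simp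
      then have "a = \<iota> c \<or> a = b" using cb(3) by blast
      then show "head G a \<in> T"
      proof
        assume "a = \<iota> c"
        then have "head G a = tail G c" using cS head_inv by simp
        moreover have "c \<in> Out (tail G c)" using cS by (simp add: Out_def)
        ultimately show ?thesis using O_T[OF tail_in_verts[OF cS(2)]] by force
      next
        assume "a = b"
        then show ?thesis using a(1) cS by (auto simp: T_def In_def)
      qed
    next
      obtain a where "a \<in> S" using S(2) by blast
      then have "head G a \<in> T" using S(1) by (auto simp: T_def In_def)
      then show "T \<noteq> {}" by blast
    qed (auto simp: T_def)
    then have "In v0 \<noteq> {}" using big(1) unfolding T_def by blast
    from cases[OF big(1) this] True obtain a b where "out_arcs G v0 = {a, b}" by blast
    then have "out_degree G v0 \<le> 2" by (simp add: out_degree_def card_insert_if)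
    then show ?thesis using big(2) by simp
  qed
qed

text \<open>The arcs reachable from \<open>x\<close> form a closed set, so
  \<open>nb_closed_set_eq_arcs\<close> gives irreducibility. Branching occurs at an arc entering
  \<open>v0\<close>: after removing the backtracking one, at least two continuations remain.\<close>

lemma (in fin_multigraph) irreducible_branching_nb_step:
  assumes conn: "Digraph_Component.connected G"
    and deg: "\<And>v. v \<in> verts G \<Longrightarrow> out_degree G v \<ge> 2"
    and big: "v0 \<in> verts G" "out_degree G v0 > 2"
  shows "irreducible_branching nb_step (arcs G)"
proof
  have cont: "card (out_arcs G (head G a) - {\<iota> a}) = out_degree G (head G a) - 1"
    if "a \<in> arcs G" for a
    using that by (simp add: out_degree_def inv_in_arcs tail_inv)
  have step: "{b. nb_step a b} = out_arcs G (head G a) - {\<iota> a}" if "a \<in> arcs G" for a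
    using that by (auto simp: nb_step_def)
  show "\<exists>y. nb_step x y" if "x \<in> arcs G" for x
  proof -
    have "card {b. nb_step x b} > 0"
      unfolding step[OF that] cont[OF that] using deg[of "head G x"] that by simp
    then show ?thesis by (auto simp: card_gt_0_iff)
  qed
  show "nb_step\<^sup>*\<^sup>* x y" if "x \<in> arcs G" "y \<in> arcs G" for x y
  proof -
    have "z \<in> arcs G" if "nb_step\<^sup>*\<^sup>* x z" for z
      using that \<open>x \<in> arcs G\<close> by (induction rule: rtranclp_induct) (auto simp: nb_step_def)
    then have "{z. nb_step\<^sup>*\<^sup>* x z} = arcs G"
      by (intro nb_closed_set_eq_arcs[OF conn deg big]) auto
    then show ?thesis using that by blast
  qed
  have "out_arcs G v0 \<noteq> {}" using big(2) by (auto simp: out_degree_def)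
  then obtain c where "c \<in> out_arcs G v0" by blast
  then have c: "c \<in> arcs G" "tail G c = v0" by auto
  have card: "card {b. nb_step (\<iota> c) b} \<ge> 2"
    unfolding step[OF inv_in_arcs[OF c(1)]] cont[OF inv_in_arcs[OF c(1)]]
    using big(2) c by (simp add: head_inv)
  then have "finite {b. nb_step (\<iota> c) b}" by (auto intro: card_ge_0_finite)
  moreover have "{b. nb_step (\<iota> c) b} \<noteq> {}" using card by force
  ultimately have "\<exists>y z. nb_step (\<iota> c) y \<and> nb_step (\<iota> c) z \<and> y \<noteq> z"
  proof (cases rule: finite_nonempty_singleton_cases)
    case (1 y)
    then show ?thesis using card by simp
  qed blast
  then show "\<exists>x\<in>arcs G. \<exists>y z. nb_step x y \<and> nb_step x z \<and> y \<noteq> z"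
    using inv_in_arcs[OF c(1)] by blast
qed (auto simp: nb_step_def)

section \<open>Girth and coverings\<close>

context multigraph
begin

text \<open>At a repeated vertex, keep the closed segment between the two visits. A contiguous
  segment is still non-backtracking, whereas deleting the segment could create a backtrack at the
  seam.\<close>

lemma nb_closed_imp_cycle:
  assumes "nb_awalk u w u" "w \<noteq> []"
  obtains c where "cycle c" "non_backtracking \<iota> c" "length c \<le> length w"
proof -
  have "\<exists>c. cycle c \<and> non_backtracking \<iota> c \<and> length c \<le> length w"
    using assms
  proof (induction "length w" arbitrary: u w rule: less_induct)
    case less
    have aw: "awalk u w u" and nb: "non_backtracking \<iota> w"
      using less.prems by (auto simp: nb_awalk_def)
    show ?case
    proof (cases "distinct (tl (awalk_verts u w))")
      case True
      then show ?thesis using aw nb less.prems(2) by (auto simp: cycle_def)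
    next
      case False
      then obtain e es where w: "w = e # es" using less.prems(2) by (cases w) auto
      with False aw have "awalk (head G e) es u" "\<not> distinct (awalk_verts (head G e) es)"
        by (auto simp: awalk_Cons_iff)
      from awalk_not_distinct_decomp[OF this]
      obtain q r s x where r: "es = q @ r @ s" "r \<noteq> []" "awalk x r x" by auto
      have "non_backtracking \<iota> r"
        using nb by (auto simp: w r non_backtracking_def successively_Cons successively_append_iff)
      then obtain c where "cycle c" "non_backtracking \<iota> c" "length c \<le> length r"
        using less.hyps[of r x] r by (auto simp: w nb_awalk_def)
      then show ?thesis by (intro exI[of _ c]) (auto simp: w r)
    qed
  qed
  then show thesis using that by blast
qed

lemma girth_le_nb_closed:
  assumes "nb_awalk u w u" "w \<noteq> []"
  shows "girth G \<iota> \<le> enat (length w)"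
proof -
  obtain c where c: "cycle c" "non_backtracking \<iota> c" "length c \<le> length w"
    using nb_closed_imp_cycle[OF assms] .
  have "girth G \<iota> \<le> enat (length c)"
    unfolding girth_def using c by (intro INF_lower) auto
  then show ?thesis using c(3) by (meson enat_ord_simps(1) order_trans)
qed

lemma le_girthI:
  assumes "\<And>u w. nb_awalk u w u \<Longrightarrow> w \<noteq> [] \<Longrightarrow> g \<le> length w"
  shows "enat g \<le> girth G \<iota>"
  unfolding girth_def
proof (rule INF_greatest)
  fix c assume "c \<in> {p. cycle p \<and> non_backtracking \<iota> p}"
  then obtain u where "nb_awalk u c u" "c \<noteq> []" by (auto simp: cycle_def nb_awalk_def)
  then show "enat g \<le> enat (length c)" using assms by simp
qed

text \<open>Strip common first arcs. Where the first arcs differ, \<open>q\<close> backwards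
  followed by \<open>p\<close> does not backtrack at the junction and is closed of length
  \<open>2 * length p\<close>. A possible backtrack at \<open>v\<close> is harmless, since
  \<open>girth_le_nb_closed\<close> asks nothing at the base point.\<close>

lemma nb_awalk_unique_below_girth:
  assumes "nb_awalk u p v" "nb_awalk u q v" "length p = length q"
    and "enat (2 * length p) < girth G \<iota>"
  shows "p = q"
  using assms
proof (induction p arbitrary: u q)
  case (Cons a p)
  then obtain b q' where q: "q = b # q'" by (cases q) auto
  show ?case
  proof (cases "a = b")
    case True
    have "enat (2 * length p) \<le> enat (2 * length (a # p))" by simp
    then have "enat (2 * length p) < girth G \<iota>" using Cons.prems(4) by (rule le_less_trans)
    then show ?thesis
      using Cons.IH[of "head G a" q'] Cons.prems True by (auto simp: q nb_awalk_Cons_iff)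
  next
    case False
    have "a \<in> arcs G" "b \<in> arcs G" using Cons.prems by (auto simp: q nb_awalk_Cons_iff)
    then have "nb_awalk v (rev (map \<iota> q) @ (a # p)) v"
      using False Cons.prems
      by (intro nb_awalk_appendI[OF nb_awalk_rev]) (auto simp: q inv_inv)
    then have "girth G \<iota> \<le> enat (length (rev (map \<iota> q) @ (a # p)))"
      by (rule girth_le_nb_closed) simp
    also have "length (rev (map \<iota> q) @ (a # p)) = 2 * length (a # p)"
      using Cons.prems(3) by simp
    finally show ?thesis using Cons.prems(4) leD by blast
  qed
qed simp

text \<open>Repeating the first arc at the end encodes both closedness and the absence of a
  backtrack at the base point, so the notion is invariant under rotation.\<close>

definition cyc_nb :: "'e list \<Rightarrow> bool" where
  "cyc_nb w \<longleftrightarrow> w \<noteq> [] \<and> successively nb_step (w @ [hd w])"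

lemma cyc_nb_append_iff:
  assumes "p \<noteq> []" "q \<noteq> []"
  shows "cyc_nb (p @ q) \<longleftrightarrow> successively nb_step p \<and> successively nb_step q \<and>
    nb_step (last p) (hd q) \<and> nb_step (last q) (hd p)"
proof -
  have "cyc_nb (p @ q) \<longleftrightarrow> successively nb_step (p @ (q @ [hd p]))"
    using assms by (simp add: cyc_nb_def)
  then show ?thesis
    using assms by (simp only: successively_append_iff hd_append2 append_is_Nil_conv) auto
qed

lemma cyc_nb_rotate:
  assumes "cyc_nb (p @ q)"
  shows "cyc_nb (q @ p)"
proof (cases "p = [] \<or> q = []")
  case False
  then show ?thesis using assms cyc_nb_append_iff[of p q] cyc_nb_append_iff[of q p] by blast
qed (use assms in auto)

lemma cyc_nb_arcs: "cyc_nb w \<Longrightarrow> set w \<subseteq> arcs G"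
proof
  fix a assume "cyc_nb w" "a \<in> set w"
  then obtain p q where w: "w = p @ a # q" by (auto dest: split_list)
  then have "cyc_nb (a # q @ p)" using cyc_nb_rotate[of p "a # q"] \<open>cyc_nb w\<close> by simp
  then show "a \<in> arcs G"
    by (cases "q @ p") (auto simp: cyc_nb_def nb_step_def)
qed

lemma cyc_nb_iff_nb_closed:
  "cyc_nb w \<longleftrightarrow> w \<noteq> [] \<and> nb_awalk (tail G (hd w)) w (tail G (hd w)) \<and> hd w \<noteq> \<iota> (last w)"
proof (cases "w = []")
  case False
  have "cyc_nb w \<longleftrightarrow> set w \<subseteq> arcs G \<and> successively nb_step w \<and> nb_step (last w) (hd w)"
    using False cyc_nb_arcs[of w] by (auto simp: cyc_nb_def successively_append_iff)
  moreover have "nb_step (last w) (hd w) \<longleftrightarrow> tail G (hd w) = head G (last w) \<and> hd w \<noteq> \<iota> (last w)"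
    if "set w \<subseteq> arcs G"
    using that hd_in_set[OF False] last_in_set[OF False] unfolding nb_step_def by blast
  ultimately show ?thesis using False by (auto simp: nb_awalk_iff)
qed (simp add: cyc_nb_def)

text \<open>While the first arc is the reversal of the last, strip both. This never exhausts the
  walk: length \<open>1\<close> would give a fixed point of \<open>\<iota>\<close>, and length
  \<open>2\<close> a backtrack.\<close>

lemma nb_closed_imp_cyc_nb:
  assumes "\<And>a. a \<in> arcs G \<Longrightarrow> \<iota> a \<noteq> a" "nb_awalk u w u" "w \<noteq> []"
  obtains w' where "cyc_nb w'" "length w' \<le> length w"
proof -
  have "\<exists>w'. cyc_nb w' \<and> length w' \<le> length w"
    using assms(2,3)
  proof (induction "length w" arbitrary: u w rule: less_induct)
    case less
    show ?case
    proof (cases "hd w = \<iota> (last w)")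
      case False
      then have "cyc_nb w" using less.prems by (auto simp: cyc_nb_iff_nb_closed nb_awalk_iff)
      then show ?thesis by blast
    next
      case True
      have arcs: "set w \<subseteq> arcs G" using less.prems by (simp add: nb_awalk_iff)
      obtain b v where w: "w = v @ [b]" using less.prems(2) by (cases w rule: rev_cases) auto
      have "v \<noteq> []" using True arcs assms(1)[of b] by (auto simp: w)
      then obtain a p where v: "v = a # p" by (cases v) auto
      have ab: "a = \<iota> b" "a \<in> arcs G" "b \<in> arcs G" using True w v arcs by auto
      have closed: "nb_awalk (head G a) p (head G a)" and "p \<noteq> []"
      proof -
        have "nb_awalk (head G a) (p @ [b]) u" using less.prems(1) by (simp add: w v nb_awalk_Cons_iff)
        then obtain y where y: "nb_awalk (head G a) p y" "nb_awalk y [b] u"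
          by (rule nb_awalk_appendD)
        then have "y = head G a" using ab by (auto simp: nb_awalk_Cons_iff head_inv)
        then show "nb_awalk (head G a) p (head G a)" using y by simp
        show "p \<noteq> []"
        proof
          assume "p = []"
          then have "b \<noteq> \<iota> a" using less.prems(1) by (auto simp: w v nb_awalk_Cons_iff)
          then show False using ab inv_inv by simp
        qed
      qed
      then obtain w' where "cyc_nb w'" "length w' \<le> length p"
        using less.hyps[of p "head G a"] by (auto simp: w v)
      then show ?thesis by (intro exI[of _ w']) (auto simp: w v)
    qed
  qed
  then show thesis using that by blast
qed

end

section \<open>Coverings and Moore's bound\<close>

locale covering = G: fin_multigraph G \<iota>G + H: fin_multigraph H \<iota>H
  for G :: "('w, 'f) pre_digraph" and \<iota>G and H :: "('v, 'e) pre_digraph" and \<iota>H +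
  fixes \<pi>v \<pi>e
  assumes covering_map: "covering_map G \<iota>G H \<iota>H \<pi>v \<pi>e"
begin

text \<open>The covering is bijective on the arcs leaving \<open>head G a\<close> and sends the
  forbidden continuation to the forbidden one, so removing both preserves bijectivity.\<close>

lemma bij_betw_nb_step:
  assumes "a \<in> arcs G"
  shows "bij_betw \<pi>e {b. G.nb_step a b} {b. H.nb_step (\<pi>e a) b}"
proof -
  have "bij_betw \<pi>e (out_arcs G (head G a)) (out_arcs H (\<pi>v (head G a)))"
    using covering_map assms by (simp add: covering_map_def)
  moreover have "\<iota>G a \<in> out_arcs G (head G a)" using assms by (simp add: G.inv_in_arcs G.tail_inv)
  ultimately have "bij_betw \<pi>e (out_arcs G (head G a) - {\<iota>G a}) (out_arcs H (\<pi>v (head G a)) - {\<pi>e (\<iota>G a)})"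
    by (auto simp: bij_betw_def inj_on_def)
  moreover have "{b. G.nb_step a b} = out_arcs G (head G a) - {\<iota>G a}"
    using assms by (auto simp: G.nb_step_def)
  moreover have "{b. H.nb_step (\<pi>e a) b} = out_arcs H (\<pi>v (head G a)) - {\<pi>e (\<iota>G a)}"
    using covering_map assms by (auto simp: H.nb_step_def covering_map_def)
  ultimately show ?thesis by simp
qed

lemma card_chains_eq:
  "a \<in> arcs G \<Longrightarrow> card (chains G.nb_step n a) = card (chains H.nb_step n (\<pi>e a))"
proof (induction n arbitrary: a)
  case (Suc n)
  have "card (chains G.nb_step (Suc n) a) = (\<Sum>b | G.nb_step a b. card (chains H.nb_step n (\<pi>e b)))"
    unfolding G.card_chains_Suc by (intro sum.cong Suc.IH) (auto simp: G.nb_step_def)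
  also have "\<dots> = card (chains H.nb_step (Suc n) (\<pi>e a))"
    unfolding H.card_chains_Suc by (rule sum.reindex_bij_betw[OF bij_betw_nb_step[OF Suc.prems]])
  finally show ?case .
qed simp

text \<open>Mapping a continuation of \<open>a\<close> to its end vertex is injective by
  \<open>nb_awalk_unique_below_girth\<close>; the number of continuations is the same in
  \<open>H\<close>.\<close>

lemma card_chains_le_card_verts:
  assumes "a \<in> arcs G" "enat (2 * n) < girth G \<iota>G"
  shows "card (chains H.nb_step n (\<pi>e a)) \<le> card (verts G)"
proof -
  let ?f = "\<lambda>p. G.awlast (head G a) p"
  have walk: "G.nb_awalk (head G a) p (?f p)" "length p = n" if p: "p \<in> chains G.nb_step n a" for p
  proof -
    obtain v where "G.nb_awalk (head G a) p v" "length p = n"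
      using p by (auto simp: G.chains_eq_nb_awalks[OF assms(1)] G.nb_awalk_Cons_iff)
    then show "G.nb_awalk (head G a) p (?f p)" "length p = n" by (auto simp: G.nb_awalk_def)
  qed
  have "inj_on ?f (chains G.nb_step n a)"
  proof (rule inj_onI)
    fix p q assume "p \<in> chains G.nb_step n a" "q \<in> chains G.nb_step n a" "?f p = ?f q"
    then show "p = q"
      using walk[of p] walk[of q] assms(2) by (intro G.nb_awalk_unique_below_girth) auto
  qed
  moreover have "?f ` chains G.nb_step n a \<subseteq> verts G"
    using walk by (auto simp: G.nb_awalk_def dest: G.awalk_last_in_verts)
  ultimately have "card (chains G.nb_step n a) \<le> card (verts G)"
    by (intro card_inj_on_le) auto
  then show ?thesis using card_chains_eq[OF assms(1)] by simp
qed

end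

section \<open>The universal cover\<close>

text \<open>A nonempty set of \<open>enat\<close> attains its infimum, and the empty set has infimum
  infinity.\<close>

lemma Inf_enat_le_iff: "Inf (A :: enat set) \<le> enat n \<longleftrightarrow> (\<exists>x\<in>A. x \<le> enat n)"
proof
  assume le: "Inf A \<le> enat n"
  then have "A \<noteq> {}" by (auto simp: top_enat_def)
  then have "Inf A \<in> A" by (auto intro: wellorder_InfI)
  then show "\<exists>x\<in>A. x \<le> enat n" using le by blast
qed (auto intro: Inf_lower2)

text \<open>Constant factors disappear in the limit, since \<open>k powr (1 / real r)\<close> tends
  to \<open>1\<close>.\<close>

lemma tendsto_exponential_growth_rate:
  fixes f :: "nat \<Rightarrow> real"
  assumes "c > 0" "C > 0" "\<rho> > 0"
    and "eventually (\<lambda>r. c * \<rho> ^ r \<le> f r) sequentially"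
    and "eventually (\<lambda>r. f r \<le> C * \<rho> ^ r) sequentially"
  shows "(\<lambda>r. f r powr (1 / real r)) \<longlonglongrightarrow> \<rho>"
proof (rule tendsto_sandwich)
  have *: "(\<lambda>r. k powr (1 / real r) * \<rho>) \<longlonglongrightarrow> \<rho>" if "k > 0" for k
  proof -
    have "(\<lambda>r. k powr (1 / real r) * \<rho>) \<longlonglongrightarrow> k powr 0 * \<rho>"
      using that by (intro tendsto_intros lim_const_over_n) auto
    then show ?thesis using that by simp
  qed
  show "(\<lambda>r. c powr (1 / real r) * \<rho>) \<longlonglongrightarrow> \<rho>" "(\<lambda>r. C powr (1 / real r) * \<rho>) \<longlonglongrightarrow> \<rho>"
    using * assms by auto
  have root: "(k * \<rho> ^ r) powr (1 / real r) = k powr (1 / real r) * \<rho>" if "k > 0" "r > 0" for k r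
    using that \<open>\<rho> > 0\<close> by (simp add: powr_mult powr_powr flip: powr_realpow)
  show "eventually (\<lambda>r. c powr (1 / real r) * \<rho> \<le> f r powr (1 / real r)) sequentially"
    using assms(4) eventually_gt_at_top[of 0]
  proof eventually_elim
    case (elim r)
    then show ?case using assms root[of c r] powr_mono2[of "1 / real r" "c * \<rho> ^ r" "f r"] by simp
  qed
  show "eventually (\<lambda>r. f r powr (1 / real r) \<le> C powr (1 / real r) * \<rho>) sequentially"
    using assms(4,5) eventually_gt_at_top[of 0]
  proof eventually_elim
    case (elim r)
    have "0 \<le> c * \<rho> ^ r" using assms by simp
    then have "0 \<le> f r" using elim by linarith
    then show ?case using elim assms root[of C r] powr_mono2[of "1 / real r" "f r" "C * \<rho> ^ r"] by simp
  qed
qed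

context fin_multigraph
begin

lemma finite_short_nb_awalks: "finite {p. length p \<le> n \<and> (\<exists>v. nb_awalk u p v)}"
proof (rule finite_subset)
  show "finite {p. set p \<subseteq> arcs G \<and> length p \<le> n}"
    by (rule finite_lists_length_le) simp
qed (auto simp: nb_awalk_def awalk_def)

text \<open>A walk of length \<open>Suc n\<close> is one of the arcs leaving \<open>u\<close>
  followed by a chain of length \<open>n\<close>. The constant comes from summing the resulting
  geometric series.\<close>

lemma card_short_nb_awalks_le:
  fixes \<rho> C :: real
  assumes "\<rho> > 1" "C \<ge> 0" and chains: "\<And>n a. a \<in> arcs G \<Longrightarrow> card (chains nb_step n a) \<le> C * \<rho> ^ n"
  shows "card {p. length p \<le> n \<and> (\<exists>v. nb_awalk u p v)}
    \<le> (1 + out_degree G u * C / (\<rho> - 1)) * \<rho> ^ n"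
proof -
  define d where "d = real (out_degree G u)"
  have K: "1 + d * C / (\<rho> - 1) \<ge> 1" using assms by (simp add: d_def)
  show ?thesis
    unfolding d_def[symmetric]
  proof (induction n)
    case 0
    have "{p. length p \<le> 0 \<and> (\<exists>v. nb_awalk u p v)} \<subseteq> {[]}" by auto
    then have "card {p. length p \<le> 0 \<and> (\<exists>v. nb_awalk u p v)} \<le> card {[] :: 'e list}"
      by (intro card_mono) auto
    then show ?case using K by simp
  next
    case (Suc n)
    let ?S = "\<lambda>n. {p. length p \<le> n \<and> (\<exists>v. nb_awalk u p v)}"
    let ?L = "\<Union>a\<in>out_arcs G u. (#) a ` chains nb_step n a"
    have "?S (Suc n) \<subseteq> ?S n \<union> ?L"
    proof
      fix p assume p: "p \<in> ?S (Suc n)"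
      show "p \<in> ?S n \<union> ?L"
      proof (cases "length p = Suc n")
        case True
        then obtain a q where "p = a # q" by (cases p) auto
        then show ?thesis using p True
          by (auto simp: nb_awalk_Cons_iff chains_eq_nb_awalks image_iff)
      qed (use p in auto)
    qed
    then have "card (?S (Suc n)) \<le> card (?S n \<union> ?L)"
      using finite_short_nb_awalks finite_chains finite_out_arcs by (intro card_mono) auto
    also have "\<dots> \<le> card (?S n) + card ?L" by (rule card_Un_le)
    also have "card ?L \<le> (\<Sum>a\<in>out_arcs G u. card (chains nb_step n a))"
      using finite_out_arcs by (intro order_trans[OF card_UN_le] sum_mono card_image_le finite_chains) auto
    finally have "real (card (?S (Suc n))) \<le> card (?S n) + (\<Sum>a\<in>out_arcs G u. real (card (chains nb_step n a)))"
      by (simp flip: of_nat_sum of_nat_add)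
    also have "\<dots> \<le> (1 + d * C / (\<rho> - 1)) * \<rho> ^ n + (\<Sum>a\<in>out_arcs G u. C * \<rho> ^ n)"
      using chains by (intro add_mono Suc.IH sum_mono) auto
    also have "\<dots> = (1 + d * C / (\<rho> - 1) + d * C) * \<rho> ^ n"
      by (simp add: d_def out_degree_def algebra_simps)
    \<comment> \<open>This identity, \<open>1 / (\<rho> - 1) + 1 = \<rho> / (\<rho> - 1)\<close>,
      dictates the denominator of the constant.\<close>
    also have "1 + d * C / (\<rho> - 1) + d * C = 1 + d * C / (\<rho> - 1) * \<rho>"
      using assms(1) by (simp add: field_simps)
    also have "\<dots> * \<rho> ^ n \<le> ((1 + d * C / (\<rho> - 1)) * \<rho>) * \<rho> ^ n"
      using assms(1) by (intro mult_right_mono) (auto simp: distrib_right)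
    finally show ?case by simp
  qed
qed

lemma nb_walks_eq: "nb_walks G \<iota> u = {p. \<exists>v. nb_awalk u p v}"
  by (auto simp: nb_walks_def nb_awalk_def)

lemma nb_walks_prefix: "p @ q \<in> nb_walks G \<iota> u \<Longrightarrow> p \<in> nb_walks G \<iota> u"
  by (auto simp: nb_walks_eq elim: nb_awalk_appendD)

lemma universal_cover_simps [simp]:
  "verts (universal_cover G \<iota> u) = nb_walks G \<iota> u"
  "arcs (universal_cover G \<iota> u) =
    {(p, q). p \<in> nb_walks G \<iota> u \<and> q \<in> nb_walks G \<iota> u \<and> (\<exists>e. q = p @ [e] \<or> p = q @ [e])}"
  "tail (universal_cover G \<iota> u) = fst" "head (universal_cover G \<iota> u) = snd"
  by (simp_all add: universal_cover_def)

lemma wf_universal_cover: "wf_digraph (universal_cover G \<iota> u)"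
  by unfold_locales auto

text \<open>An arc of the universal cover changes the length of a walk by one.\<close>

lemma graph_ball_universal_cover_upper:
  "graph_ball (universal_cover G \<iota> u) r p \<subseteq> {q. length q \<le> length p + r \<and> (\<exists>v. nb_awalk u q v)}"
proof
  interpret T: wf_digraph "universal_cover G \<iota> u" by (rule wf_universal_cover)
  have len: "length q \<le> length p + length w" if "T.awalk q w p" for q w
    using that
  proof (induction w arbitrary: q)
    case (Cons e w)
    then have "length (snd e) \<le> length p + length w" "length q \<le> length (snd e) + 1"
      by (auto simp: T.awalk_Cons_iff)
    then show ?case by simp
  qed (simp add: T.awalk_Nil_iff)
  then show "q \<in> {q. length q \<le> length p + r \<and> (\<exists>v. nb_awalk u q v)}"
    if q: "q \<in> graph_ball (universal_cover G \<iota> u) r p" for q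
  proof -
    obtain w where "T.awalk q w p" "length w \<le> r" "q \<in> nb_walks G \<iota> u"
      using q by (auto simp: graph_ball_def graph_dist_def Inf_enat_le_iff)
    then show ?thesis using len[of q w] by (simp add: nb_walks_eq)
  qed
qed

text \<open>Go from \<open>q\<close> to the root \<open>[]\<close> by dropping last arcs, then from
  the root to \<open>p\<close> by appending them.\<close>

lemma graph_ball_universal_cover_lower:
  assumes "p \<in> nb_walks G \<iota> u"
  shows "{q. length p + length q \<le> r \<and> (\<exists>v. nb_awalk u q v)} \<subseteq> graph_ball (universal_cover G \<iota> u) r p"
proof
  interpret T: wf_digraph "universal_cover G \<iota> u" by (rule wf_universal_cover)
  have arc: "T.awalk p [(p, q)] q"
    if "p \<in> nb_walks G \<iota> u" "q \<in> nb_walks G \<iota> u" "\<exists>e. q = p @ [e] \<or> p = q @ [e]" for p q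
    using that by (auto simp: T.awalk_simps)
  have up: "\<exists>w. T.awalk q w [] \<and> length w = length q" and down: "\<exists>w. T.awalk [] w q \<and> length w = length q"
    if "q \<in> nb_walks G \<iota> u" for q
    using that
  proof (induction q rule: rev_induct)
    case Nil
    {
      case 1
      then show ?case by (intro exI[of _ "[]"]) (simp add: T.awalk_Nil_iff)
    next
      case 2
      then show ?case by (intro exI[of _ "[]"]) (simp add: T.awalk_Nil_iff)
    }
  next
    case (snoc e q)
    {
      case 1
      have q: "q \<in> nb_walks G \<iota> u" using nb_walks_prefix[OF 1] .
      obtain w where w: "T.awalk q w []" "length w = length q" using snoc.IH(1)[OF q] by blast
      have w': "T.awalk (q @ [e]) ([(q @ [e], q)] @ w) []"
        by (rule T.awalk_appendI[OF arc w(1)]) (use 1 q in auto)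
      show ?case by (intro exI conjI, rule w') (simp add: w(2))
    next
      case 2
      have q: "q \<in> nb_walks G \<iota> u" using nb_walks_prefix[OF 2] .
      obtain w where w: "T.awalk [] w q" "length w = length q" using snoc.IH(2)[OF q] by blast
      have w': "T.awalk [] (w @ [(q, q @ [e])]) (q @ [e])"
        by (rule T.awalk_appendI[OF w(1) arc]) (use 2 q in auto)
      show ?case by (intro exI conjI, rule w') (simp add: w(2))
    }
  qed
  fix q assume q: "q \<in> {q. length p + length q \<le> r \<and> (\<exists>v. nb_awalk u q v)}"
  then have q': "q \<in> nb_walks G \<iota> u" by (simp add: nb_walks_eq)
  obtain w1 w2 where "T.awalk q w1 []" "length w1 = length q" "T.awalk [] w2 p" "length w2 = length p"
    using up[OF q'] down[OF assms] by blast
  then have "T.awalk q (w1 @ w2) p" "length (w1 @ w2) \<le> r"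
    using q by (auto intro: T.awalk_appendI)
  then have "graph_dist (universal_cover G \<iota> u) q p \<le> enat r"
    unfolding graph_dist_def by (intro INF_lower2[of "w1 @ w2"]) auto
  then show "q \<in> graph_ball (universal_cover G \<iota> u) r p"
    using q' by (simp add: graph_ball_def)
qed

text \<open>With \<open>l = length p\<close>, the ball about \<open>p\<close> lies between the sets
  of walks of length at most \<open>r - l\<close> and at most \<open>l + r\<close>. The shift by
  \<open>l\<close> costs only a constant factor, which the \<open>r\<close>-th root removes.\<close>

lemma growth_rate_universal_cover:
  fixes \<rho> C :: real
  assumes "\<rho> > 1" "C > 0"
    and lower: "\<And>n a. a \<in> arcs G \<Longrightarrow> \<rho> ^ n \<le> C * card (chains nb_step n a)"
    and upper: "\<And>n a. a \<in> arcs G \<Longrightarrow> card (chains nb_step n a) \<le> C * \<rho> ^ n"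
    and "out_arcs G u \<noteq> {}" and p: "p \<in> verts (universal_cover G \<iota> u)"
  shows "growth_rate (universal_cover G \<iota> u) p = \<rho>"
proof -
  let ?S = "\<lambda>n. {q. length q \<le> n \<and> (\<exists>v. nb_awalk u q v)}"
  let ?B = "\<lambda>r. graph_ball (universal_cover G \<iota> u) r p"
  define l where "l = length p"
  define K where "K = 1 + out_degree G u * C / (\<rho> - 1)"
  have p': "p \<in> nb_walks G \<iota> u" using p by simp
  have fin: "finite (?B r)" for r
    by (rule finite_subset[OF graph_ball_universal_cover_upper finite_short_nb_awalks])
  have "real (card (?B r)) \<le> K * \<rho> ^ l * \<rho> ^ r" for r
  proof -
    have "real (card (?B r)) \<le> card (?S (l + r))"
      unfolding of_nat_le_iff l_def
      by (intro card_mono graph_ball_universal_cover_upper finite_short_nb_awalks)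
    also have "\<dots> \<le> K * \<rho> ^ (l + r)"
      unfolding K_def using assms(1,2) by (intro card_short_nb_awalks_le upper) auto
    finally show ?thesis by (simp add: power_add)
  qed
  moreover have "1 / (C * \<rho> ^ Suc l) * \<rho> ^ r \<le> card (?B r)" if r: "r > l" for r
  proof -
    \<comment> \<open>Of the available length \<open>r - l = Suc n\<close>, one unit is spent on a
      fixed first arc \<open>a\<close> and \<open>n\<close> on a chain; hence the exponent
      \<open>Suc l\<close> in the constant.\<close>
    obtain a where a: "a \<in> arcs G" "tail G a = u" using assms(5) by fastforce
    obtain n where n: "r = Suc (l + n)" using less_iff_Suc_add[of l r] r by auto
    have "card (chains nb_step n a) = card ((#) a ` chains nb_step n a)"
      by (simp add: card_image)
    also have "\<dots> \<le> card (?B r)"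
      using a n by (intro card_mono fin subset_trans[OF _ graph_ball_universal_cover_lower[OF p']])
        (auto simp: chains_eq_nb_awalks l_def)
    finally have "real (card (chains nb_step n a)) \<le> card (?B r)" by simp
    then have "C * real (card (chains nb_step n a)) \<le> C * card (?B r)"
      using assms(2) by (intro mult_left_mono) auto
    then have "\<rho> ^ n \<le> C * card (?B r)" using lower[OF a(1), of n] by linarith
    moreover have "1 / (C * \<rho> ^ Suc l) * \<rho> ^ r = \<rho> ^ n / C"
      using assms(1) by (simp add: n power_add)
    ultimately show ?thesis using assms(2) by (simp add: divide_le_eq mult.commute)
  qed
  moreover have "K > 0" "1 / (C * \<rho> ^ Suc l) > 0" using assms by (auto simp: K_def add_pos_nonneg)
  ultimately have "(\<lambda>r. real (card (?B r)) powr (1 / real r)) \<longlonglongrightarrow> \<rho>"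
    using assms(1)
    by (intro tendsto_exponential_growth_rate[where c = "1 / (C * \<rho> ^ Suc l)" and C = "K * \<rho> ^ l"])
      (auto intro: eventually_mono[OF eventually_gt_at_top[of l]])
  then show ?thesis by (simp add: growth_rate_def limI)
qed

end

section \<open>Switching in a covering\<close>

text \<open>
  A lift is determined by its reversal \<open>J\<close> once the arcs \<open>D\<close>, their tails \<open>t\<close> and the projections are
  fixed, since the head of \<open>d\<close> is \<open>t (J d)\<close>. Only fixed-point-free \<open>J\<close> are used, so that a half-loop
  of \<open>H\<close> never lifts to a half-loop.
\<close>

locale fibered_darts = H: fin_multigraph H \<iota>H
  for H :: "('v, 'e) pre_digraph" and \<iota>H :: "'e \<Rightarrow> 'e" +
  fixes W :: "'w set" and D :: "'f set" and t :: "'f \<Rightarrow> 'w" and \<pi>v :: "'w \<Rightarrow> 'v" and \<pi>e :: "'f \<Rightarrow> 'e"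
  assumes finite_W: "finite W" and finite_D: "finite D"
    and t_in_W: "d \<in> D \<Longrightarrow> t d \<in> W"
    and \<pi>v_image: "\<pi>v ` W = verts H" and \<pi>e_image: "\<pi>e ` D = arcs H"
    and bij_betw_out: "w \<in> W \<Longrightarrow> bij_betw \<pi>e {d \<in> D. t d = w} (out_arcs H (\<pi>v w))"
begin

lemma \<pi>e_in_arcs: "d \<in> D \<Longrightarrow> \<pi>e d \<in> arcs H"
  using \<pi>e_image by blast

lemma tail_\<pi>e: "d \<in> D \<Longrightarrow> tail H (\<pi>e d) = \<pi>v (t d)"
  using bij_betw_out[OF t_in_W, of d] by (auto simp: bij_betw_def)

lemma dart_eqI: "d \<in> D \<Longrightarrow> d' \<in> D \<Longrightarrow> t d = t d' \<Longrightarrow> \<pi>e d = \<pi>e d' \<Longrightarrow> d = d'"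
  using bij_betw_out[OF t_in_W, of d] by (auto simp: bij_betw_def inj_on_def)

definition gluing :: "('f \<Rightarrow> 'f) \<Rightarrow> bool" where
  "gluing J \<longleftrightarrow> (\<forall>d\<in>D. J d \<in> D \<and> J (J d) = d \<and> J d \<noteq> d \<and> \<pi>e (J d) = \<iota>H (\<pi>e d))"

definition glue :: "('f \<Rightarrow> 'f) \<Rightarrow> ('w, 'f) pre_digraph" where
  "glue J = \<lparr>verts = W, arcs = D, tail = t, head = t \<circ> J\<rparr>"

lemma glue_simps [simp]:
  "verts (glue J) = W" "arcs (glue J) = D" "tail (glue J) = t" "head (glue J) d = t (J d)"
  by (simp_all add: glue_def)

lemma covering_glue:
  assumes "gluing J"
  shows "covering (glue J) J H \<iota>H \<pi>v \<pi>e"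
proof unfold_locales
  have head: "head H (\<pi>e d) = \<pi>v (t (J d))" if "d \<in> D" for d
  proof -
    have "\<pi>v (t (J d)) = tail H (\<iota>H (\<pi>e d))"
      using assms that tail_\<pi>e[of "J d"] by (auto simp: gluing_def)
    then show ?thesis using \<pi>e_in_arcs[OF that] by (simp add: H.tail_inv)
  qed
  show "covering_map (glue J) J H \<iota>H \<pi>v \<pi>e"
    unfolding covering_map_def using assms head tail_\<pi>e \<pi>v_image \<pi>e_image bij_betw_out
    by (auto simp: gluing_def out_arcs_def)
qed (use assms finite_W finite_D t_in_W in \<open>auto simp: gluing_def\<close>)

text \<open>Conjugation by a transposition keeps a fixed-point-free involution one. When
  \<open>x\<close>, \<open>y\<close>, \<open>J x\<close>, \<open>J y\<close> are distinct, it pairs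
  \<open>x\<close> with \<open>J y\<close> and \<open>y\<close> with \<open>J x\<close>.\<close>

definition switch :: "'f \<Rightarrow> 'f \<Rightarrow> ('f \<Rightarrow> 'f) \<Rightarrow> 'f \<Rightarrow> 'f" where
  "switch x y J = Transposition.transpose x y \<circ> J \<circ> Transposition.transpose x y"

lemma gluing_switch:
  assumes J: "gluing J" and xy: "x \<in> D" "y \<in> D" "\<pi>e x = \<pi>e y"
  shows "gluing (switch x y J)"
proof -
  have D: "Transposition.transpose x y d \<in> D" if "d \<in> D" for d
    using that xy by (simp add: Transposition.transpose_def)
  have \<pi>: "\<pi>e (Transposition.transpose x y d) = \<pi>e d" for d
    using xy by (simp add: Transposition.transpose_def)
  show ?thesis
    unfolding gluing_def
  proof (intro ballI conjI)
    fix d assume "d \<in> D"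
    note d = D[OF this]
    show "switch x y J d \<in> D" using J d D by (auto simp: switch_def gluing_def)
    show "switch x y J (switch x y J d) = d" using J d by (auto simp: switch_def gluing_def)
    show "\<pi>e (switch x y J d) = \<iota>H (\<pi>e d)" using J d \<pi> by (auto simp: switch_def gluing_def)
    show "switch x y J d \<noteq> d"
    proof
      assume "switch x y J d = d"
      then have "J (Transposition.transpose x y d) = Transposition.transpose x y d"
        by (metis comp_apply switch_def transpose_involutory)
      then show False using J d by (auto simp: gluing_def)
    qed
  qed
qed

abbreviation glue_nb_step where "glue_nb_step J \<equiv> multigraph.nb_step (glue J) J"
abbreviation glue_nb_awalk where "glue_nb_awalk J \<equiv> multigraph.nb_awalk (glue J) J"
abbreviation glue_cyc_nb where "glue_cyc_nb J \<equiv> multigraph.cyc_nb (glue J) J"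

text \<open>
  Cutting the arcs \<open>x\<close>, \<open>y\<close> of a fibre and regluing them crosswise creates no short closed walks if
  \<open>x\<close> and \<open>y\<close> are far apart: a short segment between two visits to the new arcs starts and ends on
  the same side, so that it closes up to a short closed walk that existed before.
\<close>

lemma switch_avoids:
  assumes J: "gluing J" and xy: "x \<in> D" "y \<in> D" "\<pi>e x = \<pi>e y"
    and girth: "\<And>w. glue_cyc_nb J w \<Longrightarrow> k \<le> length w"
    and far: "\<And>u v p. u \<in> {t x, t (J x)} \<Longrightarrow> v \<in> {t y, t (J y)} \<Longrightarrow> glue_nb_awalk J u p v \<Longrightarrow> k \<le> length p"
    and w: "glue_cyc_nb (switch x y J) w" "length w \<le> k"
  shows "set w \<inter> {x, y, J x, J y} = {}" "glue_cyc_nb J w"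
proof -
  define J' where "J' = switch x y J"
  define S where "S = {x, y, J x, J y}"
  interpret G: covering "glue J" J H \<iota>H \<pi>v \<pi>e by (rule covering_glue[OF J])
  interpret G': covering "glue J'" J' H \<iota>H \<pi>v \<pi>e
    unfolding J'_def by (rule covering_glue[OF gluing_switch[OF J xy]])
  have Jd: "J d \<in> D" "J (J d) = d" "J d \<noteq> d" if "d \<in> D" for d
    using J that by (auto simp: gluing_def)
  have "w \<noteq> []" using w(1) by (auto simp: G'.G.cyc_nb_def simp flip: J'_def)
  then have "k > 0" using w(2) by (cases w) auto
  \<comment> \<open>The empty walk has length less than \<open>k\<close>, so \<open>far\<close>
    separates the ends of \<open>x\<close> from those of \<open>y\<close>.\<close>
  have ne: "u \<noteq> v" if "u \<in> {t x, t (J x)}" "v \<in> {t y, t (J y)}" for u v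
    using far[OF that, of "[]"] that xy Jd t_in_W \<open>k > 0\<close> by auto
  have neq: "t x \<noteq> t y" "t x \<noteq> t (J y)" "t (J x) \<noteq> t y" "t (J x) \<noteq> t (J y)"
    using ne by blast+
  have dist: "x \<noteq> y" "x \<noteq> J y" "J x \<noteq> y" "J x \<noteq> J y" "x \<noteq> J x" "y \<noteq> J y" "J x \<noteq> x" "J y \<noteq> y" "y \<noteq> x"
    using neq Jd(3)[OF xy(1)] Jd(3)[OF xy(2)] by metis+
  have J': "J' x = J y" "J' y = J x" "J' (J x) = y" "J' (J y) = x"
    using dist Jd xy by (simp_all add: J'_def switch_def)
  have J'_eq: "J' d = J d" if "d \<in> D" "d \<notin> S" for d
  proof -
    have "J d \<noteq> x" "J d \<noteq> y" using that Jd by (auto simp: S_def)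
    then show ?thesis using that by (auto simp: J'_def switch_def S_def Transposition.transpose_def)
  qed
  have S_D: "S \<subseteq> D" using xy Jd by (auto simp: S_def)
  \<comment> \<open>A step from \<open>a\<close> to \<open>b\<close> involves the reversal only at
    \<open>a\<close>, both for the head and for the forbidden continuation.\<close>
  have step: "glue_nb_step J a b" if "glue_nb_step J' a b" "a \<notin> S" for a b
    using that J'_eq[of a] by (auto simp: G.G.nb_step_def G'.G.nb_step_def)
  have steps: "successively (glue_nb_step J) p" if "successively (glue_nb_step J') p" "set p \<inter> S = {}" for p
    using that by (induction p rule: induct_list012) (auto simp: step)
  have far': "k \<le> length p"
    if "u \<in> {t x, t (J x)} \<and> v \<in> {t y, t (J y)} \<or> u \<in> {t y, t (J y)} \<and> v \<in> {t x, t (J x)}"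
      "glue_nb_awalk J u p v" for u v p
    using that far[of u v p] far[of v u "rev (map J p)"] G.G.nb_awalk_rev[of u p v] by auto
  show avoid: "set w \<inter> {x, y, J x, J y} = {}"
  proof (rule ccontr)
    assume "\<not> ?thesis"
    then obtain s u v where s: "s \<in> S" and uv: "w = u @ s # v"
      unfolding S_def by (metis disjoint_iff split_list)
    define q where "q = v @ u"
    have "G'.G.cyc_nb (s # q)"
      using G'.G.cyc_nb_rotate[of u "s # v"] w(1) by (simp add: uv q_def flip: J'_def)
    then have chain: "successively (glue_nb_step J') (s # q @ [s])" by (simp add: G'.G.cyc_nb_def)
    have len: "length w = Suc (length q)" by (simp add: uv q_def)
    \<comment> \<open>After rotating \<open>s\<close> to the front, \<open>s'\<close> is the next
      visit to \<open>S\<close>, possibly \<open>s\<close> again. The part \<open>p\<close> in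
      between is a walk for the old \<open>J\<close> from \<open>t z\<close>, the new head of
      \<open>s\<close>, to the tail of \<open>s'\<close>.\<close>
    have "\<exists>z\<in>set (q @ [s]). z \<in> S" using s by simp
    from split_list_first_prop[OF this]
    obtain p s' rest where split: "q @ [s] = p @ s' # rest" and s': "s' \<in> S"
      and p: "\<forall>z\<in>set p. z \<notin> S" by blast
    define z where "z = J' s"
    have z: "z \<in> S" using s J' by (auto simp: z_def S_def)
    have "s # q @ [s] = (s # p @ [s']) @ rest" by (simp add: split)
    then have chain': "successively (glue_nb_step J') (s # p @ [s'])"
      using chain by (simp only: successively_append_iff)
    have walk: "glue_nb_awalk J (t z) p (t s')"
    proof (cases "p = []")
      case True
      then show ?thesis using chain' t_in_W[of z] z S_D by (auto simp: G'.G.nb_step_def z_def)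
    next
      case False
      then have ends: "glue_nb_step J' s (hd p)" "successively (glue_nb_step J') p" "glue_nb_step J' (last p) s'"
        using chain' by (auto simp: successively_Cons successively_append_iff)
      have "set p \<subseteq> D"
        using G'.G.cyc_nb_arcs[OF \<open>G'.G.cyc_nb (s # q)\<close>] arg_cong[OF split, of set] by auto
      moreover have "successively (glue_nb_step J) p" using steps[OF ends(2)] p by blast
      moreover have "J' (last p) = J (last p)"
        using J'_eq[of "last p"] p last_in_set[OF False] \<open>set p \<subseteq> D\<close> by blast
      ultimately show ?thesis
        using ends False by (auto simp: G.G.nb_awalk_iff G'.G.nb_step_def z_def)
    qed
    have len_p: "length p \<le> length q" "rest \<noteq> [] \<Longrightarrow> length p < length q"
      using arg_cong[OF split, of length] by (auto simp: neq_Nil_conv)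
    have opposite: "(s \<in> {x, J x} \<and> z \<in> {y, J y}) \<or> (s \<in> {y, J y} \<and> z \<in> {x, J x})"
      using s J' by (auto simp: z_def S_def)
    have same_side: "(z \<in> {x, J x} \<and> s' \<in> {x, J x}) \<or> (z \<in> {y, J y} \<and> s' \<in> {y, J y})"
    proof (rule ccontr)
      assume "\<not> ?thesis"
      then have "k \<le> length p" using z s' by (intro far'[OF _ walk]) (auto simp: S_def)
      then show False using len len_p(1) w(2) by simp
    qed
    \<comment> \<open>The new arc \<open>s\<close> changes sides while \<open>p\<close> stays on
      one, so \<open>s'\<close> is a second visit to \<open>S\<close>. This saves the one unit of
      length needed for closing up \<open>p\<close> with a single extra arc.\<close>
    have "s' \<noteq> s" using opposite same_side dist by auto
    have "rest \<noteq> []"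
    proof
      assume "rest = []"
      then show False using split \<open>s' \<noteq> s\<close> by simp
    qed
    then have len': "Suc (length p) < k" using len len_p(2) w(2) by simp
    \<comment> \<open>If \<open>s' = z\<close> then \<open>p\<close> is closed already, and nonempty
      since \<open>z\<close> may not follow \<open>s\<close> directly. If \<open>s' = J z\<close>,
      the arc \<open>J z\<close> leads back to \<open>t z\<close>.\<close>
    have "s' = z \<or> s' = J z" using same_side Jd(2) xy by auto
    then obtain p' where p': "glue_nb_awalk J (t z) p' (t z)" "p' \<noteq> []" "length p' \<le> Suc (length p)"
    proof
      assume "s' = z"
      moreover have "p \<noteq> []"
      proof
        assume "p = []"
        then show False using chain' \<open>s' = z\<close> by (auto simp: G'.G.nb_step_def z_def)
      qed
      ultimately show ?thesis using that walk by simp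
    next
      assume "s' = J z"
      have zD: "z \<in> D" using z S_D by blast
      have "glue_nb_awalk J (t (J z)) [J z] (t z)"
        using Jd[OF zD] Jd(1) t_in_W zD by (simp add: G.G.nb_awalk_Cons_iff)
      moreover have "J z \<noteq> J (last p)" if "p \<noteq> []"
      proof
        assume "J z = J (last p)"
        moreover have "last p \<in> D" using walk that by (auto simp: G.G.nb_awalk_iff subset_iff)
        ultimately have "z = last p" using Jd(2) zD by metis
        then show False using p z that by auto
      qed
      ultimately have "glue_nb_awalk J (t z) (p @ [J z]) (t z)"
        using walk unfolding \<open>s' = J z\<close> by (intro G.G.nb_awalk_appendI) auto
      then show ?thesis using that[of "p @ [J z]"] by simp
    qed
    obtain w' where "glue_cyc_nb J w'" "length w' \<le> length p'"
      using G.G.nb_closed_imp_cyc_nb[OF _ p'(1,2)] Jd(3) by auto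
    then show False using girth p'(3) len' by fastforce
  qed
  have "set (w @ [hd w]) \<inter> S = {}" using avoid \<open>w \<noteq> []\<close> by (auto simp: S_def)
  then show "glue_cyc_nb J w"
    using steps w(1) \<open>w \<noteq> []\<close> unfolding G.G.cyc_nb_def by (simp add: G'.G.cyc_nb_def flip: J'_def)
qed

text \<open>Vertices near an end of \<open>x\<close> lie in two balls, and each such vertex excludes
  at most two darts of the fibre, one by its tail and one by its head. Hence the factor
  \<open>4\<close>.\<close>

lemma exists_far_dart:
  assumes J: "gluing J" and x: "x \<in> D"
    and large: "\<And>u. u \<in> W \<Longrightarrow>
      4 * card {p. length p \<le> k \<and> (\<exists>v. glue_nb_awalk J u p v)} < card {d \<in> D. \<pi>e d = \<pi>e x}"
  obtains y where "y \<in> D" "\<pi>e y = \<pi>e x"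
    "\<And>u v p. u \<in> {t x, t (J x)} \<Longrightarrow> v \<in> {t y, t (J y)} \<Longrightarrow> glue_nb_awalk J u p v \<Longrightarrow> k < length p"
proof -
  interpret G: covering "glue J" J H \<iota>H \<pi>v \<pi>e by (rule covering_glue[OF J])
  have Jd: "J d \<in> D" "J (J d) = d" "\<pi>e (J d) = \<iota>H (\<pi>e d)" if "d \<in> D" for d
    using J that by (auto simp: gluing_def)
  define B where "B u = {v. \<exists>p. length p \<le> k \<and> glue_nb_awalk J u p v}" for u
  define F where "F = {d \<in> D. \<pi>e d = \<pi>e x}"
  have B: "finite (B u)" "card (B u) \<le> card {p. length p \<le> k \<and> (\<exists>v. glue_nb_awalk J u p v)}" for u
  proof -
    have "B u \<subseteq> G.G.awlast u ` {p. length p \<le> k \<and> (\<exists>v. glue_nb_awalk J u p v)}"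
      by (fastforce simp: B_def G.G.nb_awalk_def)
    then show "finite (B u)" "card (B u) \<le> card {p. length p \<le> k \<and> (\<exists>v. glue_nb_awalk J u p v)}"
      using G.G.finite_short_nb_awalks by (auto intro: finite_surj surj_card_le)
  qed
  define U where "U = B (t x) \<union> B (t (J x))"
  have finU: "finite U" using B by (simp add: U_def)
  have cardU: "2 * card U < card F"
  proof -
    have "card U \<le> card (B (t x)) + card (B (t (J x)))" unfolding U_def by (rule card_Un_le)
    then show ?thesis
      using B(2)[of "t x"] B(2)[of "t (J x)"] large[of "t x"] large[of "t (J x)"] x Jd t_in_W
      unfolding F_def by fastforce
  qed
  have "inj_on t F" by (auto simp: inj_on_def F_def intro: dart_eqI)
  then have 1: "card (F \<inter> t -` U) \<le> card U"
    by (intro card_inj_on_le[of t]) (auto simp: finU intro: inj_on_subset)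
  \<comment> \<open>\<open>J\<close> maps the fibre injectively into a single fibre, where the tail
    determines the dart.\<close>
  have "inj_on (t \<circ> J) F"
  proof (rule inj_onI)
    fix d d' assume d: "d \<in> F" "d' \<in> F" "(t \<circ> J) d = (t \<circ> J) d'"
    then have "J d = J d'" by (intro dart_eqI) (auto simp: F_def Jd)
    then show "d = d'" using d Jd(2) unfolding F_def by (metis (mono_tags, lifting) mem_Collect_eq)
  qed
  then have 2: "card (F \<inter> (t \<circ> J) -` U) \<le> card U"
    by (intro card_inj_on_le[of "t \<circ> J"]) (auto simp: finU intro: inj_on_subset)
  have "\<not> F \<subseteq> (F \<inter> t -` U) \<union> (F \<inter> (t \<circ> J) -` U)"
  proof
    assume "F \<subseteq> (F \<inter> t -` U) \<union> (F \<inter> (t \<circ> J) -` U)"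
    then have "card F \<le> card ((F \<inter> t -` U) \<union> (F \<inter> (t \<circ> J) -` U))"
      using finite_D by (intro card_mono) (auto simp: F_def)
    also have "\<dots> \<le> card (F \<inter> t -` U) + card (F \<inter> (t \<circ> J) -` U)" by (rule card_Un_le)
    finally show False using 1 2 cardU by simp
  qed
  then obtain y where y: "y \<in> F" "t y \<notin> U" "t (J y) \<notin> U" by fastforce
  show thesis
  proof
    show "y \<in> D" "\<pi>e y = \<pi>e x" using y by (auto simp: F_def)
    show "k < length p" if "u \<in> {t x, t (J x)}" "v \<in> {t y, t (J y)}" "glue_nb_awalk J u p v" for u v p
    proof (rule ccontr)
      assume "\<not> k < length p"
      then have "length p \<le> k" by simp
      then have "v \<in> B u" using that(3) unfolding B_def by blast
      then show False using y that by (auto simp: U_def)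
    qed
  qed
qed

lemma exists_gluing_large_girth:
  assumes J0: "gluing J0"
    and large: "\<And>J u a. gluing J \<Longrightarrow> u \<in> W \<Longrightarrow> a \<in> arcs H \<Longrightarrow>
      4 * card {p. length p \<le> g \<and> (\<exists>v. glue_nb_awalk J u p v)} < card {d \<in> D. \<pi>e d = a}"
  obtains J where "gluing J" "enat g \<le> girth (glue J) J"
proof -
  have fin: "finite {w. glue_cyc_nb J w \<and> length w = k}" if "gluing J" for J k
  proof -
    interpret G: covering "glue J" J H \<iota>H \<pi>v \<pi>e by (rule covering_glue[OF that])
    show ?thesis
      by (rule finite_subset[OF _ finite_lists_length_eq[OF finite_D, of k]]) (use G.G.cyc_nb_arcs in auto)
  qed
  have "\<exists>J. gluing J \<and> (\<forall>w. glue_cyc_nb J w \<longrightarrow> k \<le> length w)" if "k \<le> g" for k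
    using that
  proof (induction k)
    case 0
    show ?case using J0 by auto
  next
    case (Suc k)
    define P where "P J \<longleftrightarrow> gluing J \<and> (\<forall>w. glue_cyc_nb J w \<longrightarrow> k \<le> length w)" for J
    define m where "m J = card {w. glue_cyc_nb J w \<and> length w = k}" for J
    obtain J1 where "P J1" using Suc by (auto simp: P_def)
    then obtain J where PJ: "P J" and min: "\<And>J'. P J' \<Longrightarrow> m J \<le> m J'"
      using ex_has_least_nat[of P J1 m] by blast
    then have J: "gluing J" and k: "\<And>w. glue_cyc_nb J w \<Longrightarrow> k \<le> length w" by (auto simp: P_def)
    interpret G: covering "glue J" J H \<iota>H \<pi>v \<pi>e by (rule covering_glue[OF J])
    have "Suc k \<le> length w" if w: "glue_cyc_nb J w" for w
    proof (rule ccontr)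
      assume "\<not> ?thesis"
      then have len: "length w = k" using k[OF w] by simp
      have "w \<noteq> []" using w by (auto simp: G.G.cyc_nb_def)
      define x where "x = hd w"
      have x: "x \<in> set w" "x \<in> D" using \<open>w \<noteq> []\<close> G.G.cyc_nb_arcs[OF w] by (auto simp: x_def)
      have large_k: "4 * card {p. length p \<le> k \<and> (\<exists>v. glue_nb_awalk J u p v)} < card {d \<in> D. \<pi>e d = \<pi>e x}"
        if "u \<in> W" for u
      proof -
        have "card {p. length p \<le> k \<and> (\<exists>v. glue_nb_awalk J u p v)}
            \<le> card {p. length p \<le> g \<and> (\<exists>v. glue_nb_awalk J u p v)}"
          using Suc.prems by (intro card_mono G.G.finite_short_nb_awalks) auto
        then show ?thesis using large[OF J that \<pi>e_in_arcs[OF x(2)]] by simp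
      qed
      obtain y where y: "y \<in> D" "\<pi>e y = \<pi>e x" and
        far: "\<And>u v p. u \<in> {t x, t (J x)} \<Longrightarrow> v \<in> {t y, t (J y)} \<Longrightarrow> glue_nb_awalk J u p v \<Longrightarrow> k < length p"
        by (rule exists_far_dart[OF J x(2) large_k]) (assumption, rule that)
      have far': "k \<le> length p"
        if "u \<in> {t x, t (J x)}" "v \<in> {t y, t (J y)}" "glue_nb_awalk J u p v" for u v p
        using far[OF that] by simp
      define J' where "J' = switch x y J"
      have J': "gluing J'" unfolding J'_def using J x(2) y by (intro gluing_switch) auto
      have avoids: "set w' \<inter> {x, y, J x, J y} = {}" "glue_cyc_nb J w'"
        if "glue_cyc_nb J' w'" "length w' \<le> k" for w'
      proof -
        note that' = that[unfolded J'_def]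
        show "set w' \<inter> {x, y, J x, J y} = {}"
          by (rule switch_avoids(1)[OF J x(2) y(1) y(2)[symmetric] k far' that'])
        show "glue_cyc_nb J w'"
          by (rule switch_avoids(2)[OF J x(2) y(1) y(2)[symmetric] k far' that'])
      qed
      have "k \<le> length w'" if "glue_cyc_nb J' w'" for w'
        using k[of w'] avoids(2)[OF that] by (cases "length w' \<le> k") auto
      then have "P J'" using J' by (simp add: P_def)
      \<comment> \<open>Every short walk after the switch was present before, while \<open>w\<close>
        itself passes through \<open>x\<close> and is lost; this contradicts minimality of
        \<open>m J\<close>.\<close>
      have "{w. glue_cyc_nb J' w \<and> length w = k} \<subset> {w. glue_cyc_nb J w \<and> length w = k}"
      proof
        show "{w. glue_cyc_nb J' w \<and> length w = k} \<subseteq> {w. glue_cyc_nb J w \<and> length w = k}"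
          using avoids(2) by auto
        have "w \<in> {w. glue_cyc_nb J w \<and> length w = k}" using w len by simp
        moreover have "w \<notin> {w. glue_cyc_nb J' w \<and> length w = k}" using avoids(1)[of w] x(1) by auto
        ultimately show "{w. glue_cyc_nb J' w \<and> length w = k} \<noteq> {w. glue_cyc_nb J w \<and> length w = k}" by blast
      qed
      then have "m J' < m J" unfolding m_def by (intro psubset_card_mono fin J)
      then show False using min[OF \<open>P J'\<close>] by simp
    qed
    then show ?case using J by blast
  qed
  then obtain J where J: "gluing J" and cyc: "\<And>w. glue_cyc_nb J w \<Longrightarrow> g \<le> length w" by blast
  interpret G: covering "glue J" J H \<iota>H \<pi>v \<pi>e by (rule covering_glue[OF J])
  \<comment> \<open>The induction controls only cyclically non-backtracking walks; absence of fixed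
    points carries the bound over to all non-backtracking closed walks, hence to the girth.\<close>
  have fpf: "J a \<noteq> a" if "a \<in> arcs (glue J)" for a using J that by (auto simp: gluing_def)
  have "enat g \<le> girth (glue J) J"
  proof (rule G.G.le_girthI)
    fix u w assume "glue_nb_awalk J u w u" "w \<noteq> []"
    then obtain w' where "glue_cyc_nb J w'" "length w' \<le> length w"
      using G.G.nb_closed_imp_cyc_nb[OF fpf] by metis
    then show "g \<le> length w" using cyc by fastforce
  qed
  then show thesis using J that by blast
qed

end

section \<open>Bounds on the size of a lift\<close>

context fin_multigraph
begin

text \<open>An explicit lift with \<open>2 * m\<close> sheets, encoded in natural numbers, is
  reglued by \<open>exists_gluing_large_girth\<close>. The hypothesis ranges over all fibered darts
  because the actual ones are built inside the proof.\<close>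

lemma min_lift_size_upper:
  assumes "m > 0" and m: "\<And>W D (t :: nat \<Rightarrow> nat) \<pi>v \<pi>e J u a.
      fibered_darts G \<iota> W D t \<pi>v \<pi>e \<Longrightarrow> fibered_darts.gluing \<iota> D \<pi>e J \<Longrightarrow> u \<in> W \<Longrightarrow>
      2 * card {p. length p \<le> g \<and> (\<exists>v. multigraph.nb_awalk (fibered_darts.glue W D t J) J u p v)} < m"
  shows "min_lift_size G \<iota> g \<le> enat (2 * m * card (verts G))"
proof -
  define n where "n = 2 * m"
  obtain fv :: "'v \<Rightarrow> nat" where fv: "inj_on fv (verts G)"
    using finite_imp_inj_to_nat_seg[OF finite_verts] by blast
  obtain fe :: "'e \<Rightarrow> nat" where fe: "inj_on fe (arcs G)"
    using finite_imp_inj_to_nat_seg[OF finite_arcs] by blast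
  define W where "W = (\<lambda>(v, i). prod_encode (fv v, i)) ` (verts G \<times> {..<n})"
  define D where "D = (\<lambda>(a, i). prod_encode (fe a, i)) ` (arcs G \<times> {..<n})"
  define \<pi>v where "\<pi>v w = inv_into (verts G) fv (fst (prod_decode w))" for w
  define \<pi>e where "\<pi>e d = inv_into (arcs G) fe (fst (prod_decode d))" for d
  define t where "t d = prod_encode (fv (tail G (\<pi>e d)), snd (prod_decode d))" for d
  \<comment> \<open>\<open>sw\<close> exchanges the sheets \<open>2 * j\<close> and
    \<open>2 * j + 1\<close>. It stays in range because \<open>n\<close> is even, and keeps
    \<open>J0\<close> fixed-point free even above half-loops.\<close>
  define sw :: "nat \<Rightarrow> nat" where "sw i = (if even i then i + 1 else i - 1)" for i
  define J0 where "J0 d = prod_encode (fe (\<iota> (\<pi>e d)), sw (snd (prod_decode d)))" for d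
  have \<pi>v [simp]: "\<pi>v (prod_encode (fv v, i)) = v" if "v \<in> verts G" for v i
    using that fv by (simp add: \<pi>v_def)
  have \<pi>e [simp]: "\<pi>e (prod_encode (fe a, i)) = a" if "a \<in> arcs G" for a i
    using that fe by (simp add: \<pi>e_def)
  have t [simp]: "t (prod_encode (fe a, i)) = prod_encode (fv (tail G a), i)" if "a \<in> arcs G" for a i
    using that by (simp add: t_def)
  have J0 [simp]: "J0 (prod_encode (fe a, i)) = prod_encode (fe (\<iota> a), sw i)" if "a \<in> arcs G" for a i
    using that by (simp add: J0_def)
  have sw: "sw i < n" if "i < n" for i
    using that by (auto simp: sw_def n_def)
  have sw_sw: "sw (sw i) = i" "sw i \<noteq> i" for i
    by (cases i; simp add: sw_def)+
  have inW: "prod_encode (fv v, i) \<in> W" if "v \<in> verts G" "i < n" for v i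
    using that by (auto simp: W_def)
  have inD: "prod_encode (fe a, i) \<in> D" if "a \<in> arcs G" "i < n" for a i
    using that by (auto simp: D_def)
  have D_E: "\<exists>a\<in>arcs G. \<exists>i<n. d = prod_encode (fe a, i)" if "d \<in> D" for d
    using that by (auto simp: D_def)
  have W_E: "\<exists>v\<in>verts G. \<exists>i<n. w = prod_encode (fv v, i)" if "w \<in> W" for w
    using that by (auto simp: W_def)
  have fv_eq: "fv v = fv v' \<longleftrightarrow> v = v'" if "v \<in> verts G" "v' \<in> verts G" for v v'
    using that fv by (auto simp: inj_on_def)
  have n_pos: "0 < n" using \<open>m > 0\<close> by (simp add: n_def)
  interpret fibered_darts G \<iota> W D t \<pi>v \<pi>e
  proof unfold_locales
    show "finite W" "finite D" by (simp_all add: W_def D_def)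
    show "t d \<in> W" if "d \<in> D" for d using D_E[OF that] by (auto intro!: inW)
    show "\<pi>v ` W = verts G"
    proof
      show "\<pi>v ` W \<subseteq> verts G" using W_E by fastforce
      show "verts G \<subseteq> \<pi>v ` W"
      proof
        fix v assume "v \<in> verts G"
        then show "v \<in> \<pi>v ` W" using inW[OF _ n_pos] by (intro image_eqI[of _ _ "prod_encode (fv v, 0)"]) auto
      qed
    qed
    show "\<pi>e ` D = arcs G"
    proof
      show "\<pi>e ` D \<subseteq> arcs G" using D_E by fastforce
      show "arcs G \<subseteq> \<pi>e ` D"
      proof
        fix a assume "a \<in> arcs G"
        then show "a \<in> \<pi>e ` D" using inD[OF _ n_pos] by (intro image_eqI[of _ _ "prod_encode (fe a, 0)"]) auto
      qed
    qed
    show "bij_betw \<pi>e {d \<in> D. t d = w} (out_arcs G (\<pi>v w))" if w: "w \<in> W" for w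
    proof -
      obtain v i where v: "v \<in> verts G" "i < n" "w = prod_encode (fv v, i)" using W_E[OF w] by blast
      have "{d \<in> D. t d = w} = (\<lambda>a. prod_encode (fe a, i)) ` out_arcs G v"
      proof (intro equalityI subsetI)
        fix d assume "d \<in> {d \<in> D. t d = w}"
        then obtain a j where "a \<in> arcs G" "d = prod_encode (fe a, j)" "t d = w" using D_E by blast
        then show "d \<in> (\<lambda>a. prod_encode (fe a, i)) ` out_arcs G v" using v by (auto simp: fv_eq)
      qed (use v in \<open>auto intro: inD\<close>)
      then show ?thesis using v by (auto simp: bij_betw_def inj_on_def image_image)
    qed
  qed
  have fibre: "card {d \<in> D. \<pi>e d = a} = n" if a: "a \<in> arcs G" for a
  proof -
    have "{d \<in> D. \<pi>e d = a} = (\<lambda>i. prod_encode (fe a, i)) ` {..<n}"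
      using a D_E by (fastforce intro: inD)
    then show ?thesis by (simp add: card_image inj_on_def)
  qed
  have J0: "gluing J0"
    unfolding gluing_def
  proof
    fix d assume "d \<in> D"
    then obtain a i where "a \<in> arcs G" "i < n" "d = prod_encode (fe a, i)" using D_E by blast
    then show "J0 d \<in> D \<and> J0 (J0 d) = d \<and> J0 d \<noteq> d \<and> \<pi>e (J0 d) = \<iota> (\<pi>e d)"
      by (auto simp: inv_in_arcs inv_inv sw sw_sw intro!: inD)
  qed
  have large: "4 * card {p. length p \<le> g \<and> (\<exists>v. multigraph.nb_awalk (glue J) J u p v)} < card {d \<in> D. \<pi>e d = a}"
    if "gluing J" "u \<in> W" "a \<in> arcs G" for J u a
    using m[OF fibered_darts_axioms that(1,2)] fibre[OF that(3)] by (simp add: n_def)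
  obtain J where J: "gluing J" "enat g \<le> girth (glue J) J"
    using exists_gluing_large_girth[OF J0 large] by blast
  interpret C: covering "glue J" J G \<iota> \<pi>v \<pi>e by (rule covering_glue[OF J(1)])
  have "is_lift (glue J) J G \<iota>" using C.covering_map by (auto simp: is_lift_def)
  then have "min_lift_size G \<iota> g \<le> enat (card (verts (glue J)))"
    unfolding min_lift_size_def using J(2) C.G.fin_multigraph_axioms by (intro Inf_lower) blast
  also have "card (verts (glue J)) \<le> card (verts G \<times> {..<n})"
    unfolding glue_simps unfolding W_def by (intro card_image_le) simp
  then have "enat (card (verts (glue J))) \<le> enat (2 * m * card (verts G))"
    by (simp add: n_def card_cartesian_product mult.commute)
  finally show ?thesis .
qed

lemma min_lift_size_lower:
  assumes "a \<in> arcs G" "2 * n < g"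
  shows "enat (card (chains nb_step n a)) \<le> min_lift_size G \<iota> g"
  unfolding min_lift_size_def
proof (rule Inf_greatest, clarify)
  fix L :: "(nat, nat) pre_digraph" and \<iota>L
  assume L: "fin_multigraph L \<iota>L" "is_lift L \<iota>L G \<iota>" "enat g \<le> girth L \<iota>L"
  then obtain \<pi>v \<pi>e where cov: "covering_map L \<iota>L G \<iota> \<pi>v \<pi>e" by (auto simp: is_lift_def)
  interpret covering L \<iota>L G \<iota> \<pi>v \<pi>e
    using L(1) cov fin_multigraph_axioms by (simp add: covering_def covering_axioms_def)
  have "a \<in> \<pi>e ` arcs L" using cov assms(1) by (simp add: covering_map_def)
  then obtain b where b: "b \<in> arcs L" "\<pi>e b = a" by blast
  have "enat (2 * n) < girth L \<iota>L" using assms(2) L(3) by (simp add: less_le_trans[of _ "enat g"])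
  then show "enat (card (chains nb_step n a)) \<le> enat (card (verts L))"
    using card_chains_le_card_verts[OF b(1)] b(2) by simp
qed

end

section \<open>Assembling the growth rate and the two bounds\<close>

theorem theorem1p1:
  fixes H :: "('v, 'e) pre_digraph" and \<iota> :: "'e \<Rightarrow> 'e"
  assumes "fin_multigraph H \<iota>"
    and "Digraph_Component.connected H"
    and "Min (out_degree H ` verts H) \<ge> 2"
    and "Max (out_degree H ` verts H) > 2"
  shows "\<exists>c1 c2 :: real. \<exists>g0 :: nat. c1 > 0 \<and> c2 > 0 \<and>
    (\<forall>v0\<in>verts H. \<forall>v\<in>verts (universal_cover H \<iota> v0). \<forall>g\<ge>g0.
       ereal (c1 * growth_rate (universal_cover H \<iota> v0) v powr (real g / 2))
         \<le> ereal_of_enat (min_lift_size H \<iota> g) \<and>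
       ereal_of_enat (min_lift_size H \<iota> g)
         \<le> ereal (c2 * growth_rate (universal_cover H \<iota> v0) v ^ g))"
proof -
  interpret H: fin_multigraph H \<iota> by (rule assms(1))
  have "verts H \<noteq> {}"
    using assms(2) by (auto simp: connected_def strongly_connected_def)
  have deg: "out_degree H v \<ge> 2" if "v \<in> verts H" for v
    using assms(3) that H.finite_verts by (auto intro: order_trans Min_le)
  have "Max (out_degree H ` verts H) \<in> out_degree H ` verts H"
    using \<open>verts H \<noteq> {}\<close> by (intro Max_in) auto
  then obtain w where w: "w \<in> verts H" "out_degree H w > 2" using assms(4) by auto
  interpret irreducible_branching H.nb_step "arcs H"
    by (rule H.irreducible_branching_nb_step[OF assms(2) deg w])
  obtain \<rho> C :: real where "\<rho> > 1" "C > 0"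
    and lower: "\<And>n a. a \<in> arcs H \<Longrightarrow> \<rho> ^ n \<le> C * card (chains H.nb_step n a)"
    and upper: "\<And>n a. a \<in> arcs H \<Longrightarrow> card (chains H.nb_step n a) \<le> C * \<rho> ^ n"
    by (rule exponential_growth) (rule that)
  have out: "out_arcs H v \<noteq> {}" if "v \<in> verts H" for v
    using deg[OF that] by (auto simp: out_degree_def)
  have rate: "growth_rate (universal_cover H \<iota> v0) v = \<rho>"
    if "v0 \<in> verts H" "v \<in> verts (universal_cover H \<iota> v0)" for v0 v
    using H.growth_rate_universal_cover[OF \<open>\<rho> > 1\<close> \<open>C > 0\<close> lower upper out[OF that(1)] that(2)] .
  obtain a where a: "a \<in> arcs H" using out[OF w(1)] by auto
  \<comment> \<open>Bounding the degree by the number of arcs makes the constant of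
    \<open>card_short_nb_awalks_le\<close> uniform over all lifts and base vertices.\<close>
  define K where "K = 1 + card (arcs H) * C / (\<rho> - 1)"
  have "K \<ge> 1" using \<open>\<rho> > 1\<close> \<open>C > 0\<close> by (simp add: K_def)
  have low: "ereal (1 / (C * \<rho>) * \<rho> powr (real g / 2)) \<le> ereal_of_enat (min_lift_size H \<iota> g)"
    if "g \<ge> 1" for g
  proof -
    \<comment> \<open>The largest \<open>n\<close> with \<open>2 * n < g\<close>. Rounding
      \<open>g / 2\<close> up to \<open>n + 1\<close> costs one factor \<open>\<rho>\<close>, which
      enters the constant \<open>1 / (C * \<rho>)\<close>.\<close>
    define n where "n = (g - 1) div 2"
    have n: "2 * n < g" "g \<le> 2 * (n + 1)" using that by (auto simp: n_def)
    have "\<rho> powr (real g / 2) \<le> \<rho> powr real (n + 1)"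
      using \<open>\<rho> > 1\<close> n(2) by (intro powr_mono) auto
    also have "\<dots> = \<rho> * \<rho> ^ n" using \<open>\<rho> > 1\<close> by (subst powr_realpow) auto
    also have "\<dots> \<le> \<rho> * (C * card (chains H.nb_step n a))"
      using \<open>\<rho> > 1\<close> lower[OF a, of n] by (intro mult_left_mono) auto
    finally have "1 / (C * \<rho>) * \<rho> powr (real g / 2) \<le> card (chains H.nb_step n a)"
      using \<open>\<rho> > 1\<close> \<open>C > 0\<close> by (simp add: divide_le_eq mult_ac)
    also have "ereal (card (chains H.nb_step n a)) \<le> ereal_of_enat (min_lift_size H \<iota> g)"
      using H.min_lift_size_lower[OF a n(1)] by (simp flip: ereal_of_enat_simps)
    finally show ?thesis by simp
  qed
  have up: "ereal_of_enat (min_lift_size H \<iota> g) \<le> ereal ((4 * K + 4) * card (verts H) * \<rho> ^ g)" for g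
  proof -
    define m where "m = nat \<lceil>2 * K * \<rho> ^ g\<rceil> + 1"
    have pow: "\<rho> ^ g \<ge> 1" using \<open>\<rho> > 1\<close> by simp
    have m: "2 * K * \<rho> ^ g < m" "m \<le> 2 * K * \<rho> ^ g + 2"
    proof -
      have "0 \<le> 2 * K * \<rho> ^ g" using pow \<open>K \<ge> 1\<close> by simp
      then show "2 * K * \<rho> ^ g < m" "m \<le> 2 * K * \<rho> ^ g + 2" unfolding m_def by linarith+
    qed
    have "min_lift_size H \<iota> g \<le> enat (2 * m * card (verts H))"
    proof (rule H.min_lift_size_upper)
      show "m > 0" by (simp add: m_def)
      fix W :: "nat set" and D :: "nat set" and t :: "nat \<Rightarrow> nat" and \<pi>v \<pi>e J u
      assume "fibered_darts H \<iota> W D t \<pi>v \<pi>e" "fibered_darts.gluing \<iota> D \<pi>e J" "u \<in> W"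
      interpret fibered_darts H \<iota> W D t \<pi>v \<pi>e by fact
      interpret C: covering "glue J" J H \<iota> \<pi>v \<pi>e by (rule covering_glue) fact
      have "out_degree (glue J) u = out_degree H (\<pi>v u)"
        using bij_betw_same_card[OF bij_betw_out[OF \<open>u \<in> W\<close>]] by (simp add: out_degree_def out_arcs_def)
      also have "\<dots> \<le> card (arcs H)" unfolding out_degree_def by (intro card_mono) auto
      finally have "real (out_degree (glue J) u) \<le> card (arcs H)" by simp
      then have "1 + out_degree (glue J) u * C / (\<rho> - 1) \<le> K"
        using \<open>\<rho> > 1\<close> \<open>C > 0\<close> by (simp add: K_def divide_right_mono)
      then have deg_le: "(1 + out_degree (glue J) u * C / (\<rho> - 1)) * \<rho> ^ g \<le> K * \<rho> ^ g"
        using pow by (intro mult_right_mono) auto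
      \<comment> \<open>Coverings preserve chain counts, so the growth constants of \<open>H\<close>
        serve every lift.\<close>
      have chains: "card (chains C.G.nb_step n b) \<le> C * \<rho> ^ n" if "b \<in> arcs (glue J)" for n b
        using C.card_chains_eq[OF that] upper[of "\<pi>e b" n] \<pi>e_in_arcs that by simp
      have "card {p. length p \<le> g \<and> (\<exists>v. C.G.nb_awalk u p v)} \<le> K * \<rho> ^ g"
        using \<open>\<rho> > 1\<close> \<open>C > 0\<close>
        by (intro order_trans[OF C.G.card_short_nb_awalks_le deg_le] chains) auto
      then have "real (2 * card {p. length p \<le> g \<and> (\<exists>v. C.G.nb_awalk u p v)}) < m" using m(1) by simp
      then show "2 * card {p. length p \<le> g \<and> (\<exists>v. C.G.nb_awalk u p v)} < m" by linarith
    qed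
    then have "ereal_of_enat (min_lift_size H \<iota> g) \<le> ereal (real (2 * m * card (verts H)))"
      by (simp only: ereal_of_enat_le_iff flip: ereal_of_enat_simps)
    also have "real (2 * m * card (verts H)) \<le> (4 * K + 4) * card (verts H) * \<rho> ^ g"
    proof -
      have "2 * real m \<le> 4 * K * \<rho> ^ g + 4 * 1" using m(2) by simp
      also have "\<dots> \<le> 4 * K * \<rho> ^ g + 4 * \<rho> ^ g" using pow by simp
      also have "\<dots> = (4 * K + 4) * \<rho> ^ g" by (simp add: distrib_right)
      finally have "2 * real m * card (verts H) \<le> (4 * K + 4) * \<rho> ^ g * card (verts H)"
        by (intro mult_right_mono) auto
      then show ?thesis by (simp add: mult_ac)
    qed
    finally show ?thesis by simp
  qed
  show ?thesis
  proof (intro exI conjI ballI allI impI)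
    show "1 / (C * \<rho>) > 0" using \<open>\<rho> > 1\<close> \<open>C > 0\<close> by simp
    show "(4 * K + 4) * card (verts H) > 0"
      using \<open>K \<ge> 1\<close> \<open>verts H \<noteq> {}\<close> by (simp add: card_gt_0_iff)
    \<comment> \<open>The threshold is \<open>g0 = 1\<close>, as \<open>low\<close> requires
      \<open>g \<ge> 1\<close>; \<open>up\<close> holds for every \<open>g\<close>.\<close>
    fix v0 v and g :: nat
    assume v: "v0 \<in> verts H" "v \<in> verts (universal_cover H \<iota> v0)" and g: "1 \<le> g"
    show "ereal (1 / (C * \<rho>) * growth_rate (universal_cover H \<iota> v0) v powr (real g / 2))
        \<le> ereal_of_enat (min_lift_size H \<iota> g)"
      using low[OF g] rate[OF v] by simp
    show "ereal_of_enat (min_lift_size H \<iota> g)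
        \<le> ereal ((4 * K + 4) * card (verts H) * growth_rate (universal_cover H \<iota> v0) v ^ g)"
      using up[of g] rate[OF v] by simp
  qed
qed

end
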